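(* Let $E$ be an infinite-dimensional Banach space over $\mathbb{F}\in\{\mathbb{R},\mathbb{C}\}$. Then $E$ is Gelfand--Phillips if one of the following conditions holds: (i) the closed unit ball $B_{E'}$ of $E'$ endowed with the weak$^\ast$ topology is selectively sequentially pseudocompact; (ii) $E$ is separable; (iii) $E$ has the separable $c_0$-extension property (equivalently, $E$ is separably weak$^\ast$-extensible); (iv) the space $E'_{w^\ast}$ is selectively sequentially pseudocompact at some $E$-norming set $S\subseteq E'$; (v) $E=C(K)$ for some infinite compact Hausdorff selectively sequentially pseudocompact space $K$; (vi) $E=C(K)$ for some infinite compact Hausdorff space $K$ such that $P(K)$ is selectively sequentially pseudocompact at some set $A\subseteq P(K)$ containing $K$ (where each $x\in K$ is identified with the Dirac measure $\delta_x\in P(K)$).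
   Context: $\mathbb{F}$ is the field of real or complex numbers, $\omega$ is the set of nonnegative integers, $E'$ is the dual Banach space of $E$, $E'_{w^\ast}$ is $E'$ with the weak$^\ast$ topology, and $c_0$ is the Banach space (over $\mathbb{F}$, with sup-norm) of null sequences. Operators are linear and continuous. For a bounded set $B\subseteq E$ and $\chi\in E'$, put $\|\chi\|_B:=\sup\{|\chi(x)|:x\in B\}$. A subset of $E$ is precompact if its closure in $E$ is compact. A bounded subset $B\subseteq E$ is limited if $\lim_n\|\chi_n\|_B=0$ for every weak$^\ast$ null sequence $(\chi_n)_{n\in\omega}$ in $E'$. The space $E$ is Gelfand--Phillips if every limited set in $E$ is precompact. A topological space $Y$ is selectively sequentially pseudocompact at a subset $A\subseteq Y$ if for any open sets $U_n\subseteq Y$, $n\in\omega$, each intersecting $A$, there exists a sequence $(x_n)_{n\in\omega}\in\prod_{n\in\omega}U_n$ containing a subsequence that converges in $Y$. The space $Y$ is selectively sequentially pseudocompact if it is selectively sequentially pseudocompact at $Y$. A (norm-)bounded subset $S\subseteq E'$ is $E$-norming if there is a constant $\lambda>0$ such that $\tfrac1\lambda\|x\|_S\le\|x\|\le\lambda\|x\|_S$ for every $x\in E$, where $\|x\|_S:=\sup_{\chi\in S}|\chi(x)|$. $E$ has the separable $c_0$-extension property if every operator $T:X\to c_0$ defined on a separable Banach subspace $X\subseteq E$ can be extended to an operator $\bar T:E\to c_0$. $E$ is separably weak$^\ast$-extensible if any weak$^\ast$ null sequence in the dual of any separable subspace of $E$ admits a subsequence which can be extended to a weak$^\ast$ null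 sequence in $E'$. For a compact Hausdorff space $K$, $C(K)$ is the Banach space of continuous $\mathbb{F}$-valued functions on $K$ with the sup-norm, and $P(K):=\{\mu\in C(K)':\|\mu\|=\mu(\mathbf{1}_K)=1\}$ is the space of probability measures with the weak$^\ast$ topology inherited from $C(K)'_{w^\ast}$. The Dirac measure is $\delta_x:C(K)\to\mathbb{F}$, $f\mapsto f(x)$, and $K$ is identified with $\{\delta_x:x\in K\}\subseteq P(K)$.
   Formalization: In (iii) "equivalently" is false (C(K), K the one-point compactified Mrówka space of an uncountable almost disjoint family); proved instead: each of the two properties implies Gelfand–Phillips, and the separable c0-extension property implies separable weak*-extensibility, without the converse. *)

theory Defs
  imports "HOL-Analysis.Analysis"
begin

section \<open>The scalar field\<close>

text \<open>
  The scalar field is either the real or the complex numbers. So that both cases can be treated by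
  one statement, we use the class of complete normed fields that are isometrically isomorphic,
  through some \<open>\<phi>\<close>, to the field of real numbers or to the field of complex numbers. Both types
  are instances.
\<close>

class real_or_complex = real_normed_field + banach +
  assumes real_or_complex:
    "\<exists>\<phi> :: 'a \<Rightarrow> complex.
       (\<forall>x y. \<phi> (x + y) = \<phi> x + \<phi> y) \<and> (\<forall>x y. \<phi> (x * y) = \<phi> x * \<phi> y) \<and>
       (\<forall>x. norm (\<phi> x) = norm x) \<and> (range \<phi> = \<real> \<or> range \<phi> = UNIV)"

instance real :: real_or_complex
proof
  show "\<exists>\<phi> :: real \<Rightarrow> complex.
       (\<forall>x y. \<phi> (x + y) = \<phi> x + \<phi> y) \<and> (\<forall>x y. \<phi> (x * y) = \<phi> x * \<phi> y) \<and>
       (\<forall>x. norm (\<phi> x) = norm x) \<and> (range \<phi> = \<real> \<or> range \<phi> = UNIV)"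
    by (intro exI[of _ complex_of_real]) (auto simp: Reals_def)
qed

instance complex :: real_or_complex
proof
  show "\<exists>\<phi> :: complex \<Rightarrow> complex.
       (\<forall>x y. \<phi> (x + y) = \<phi> x + \<phi> y) \<and> (\<forall>x y. \<phi> (x * y) = \<phi> x * \<phi> y) \<and>
       (\<forall>x. norm (\<phi> x) = norm x) \<and> (range \<phi> = \<real> \<or> range \<phi> = UNIV)"
    by (intro exI[of _ id]) auto
qed


section \<open>Banach spaces over the scalar field\<close>

text \<open>
  The library class \<^class>\<open>banach\<close> only provides real scalars. A Banach space over \<open>'f\<close> is a real
  Banach space with a compatible scalar multiplication by elements of \<open>'f\<close>. For \<open>'f = real\<close>
  the last axiom forces \<open>smul\<close> to be \<^const>\<open>scaleR\<close>.
\<close>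

locale banach_over = vector_space smul
  for smul :: "'f::real_or_complex \<Rightarrow> 'a::banach \<Rightarrow> 'a" +
  assumes norm_scale: "norm (smul c x) = norm c * norm x"
    and scale_of_real: "smul (of_real r) x = r *\<^sub>R x"

definition infinite_dimensional :: "('f::real_or_complex \<Rightarrow> 'a::banach \<Rightarrow> 'a) \<Rightarrow> bool" where
  "infinite_dimensional smul \<longleftrightarrow> \<not> (\<exists>B. finite B \<and> module.span smul B = UNIV)"

text \<open>
  The dual space consists of the \<open>'f\<close>-linear elements of the space of bounded real-linear maps
  to \<open>'f\<close>, with the operator norm of the latter. Its weak* topology is the topology
  of pointwise convergence.
\<close>

definition dual :: "('f::real_or_complex \<Rightarrow> 'a::banach \<Rightarrow> 'a) \<Rightarrow> ('a \<Rightarrow>\<^sub>L 'f) set" where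
  "dual smul = {\<xi>. \<forall>c x. blinfun_apply \<xi> (smul c x) = c * blinfun_apply \<xi> x}"

definition weak_star :: "('f::real_or_complex \<Rightarrow> 'a::banach \<Rightarrow> 'a) \<Rightarrow> ('a \<Rightarrow>\<^sub>L 'f) topology" where
  "weak_star smul = subtopology strong_operator_topology (dual smul)"

definition weak_star_null ::
    "('f::real_or_complex \<Rightarrow> 'a::banach \<Rightarrow> 'a) \<Rightarrow> (nat \<Rightarrow> 'a \<Rightarrow>\<^sub>L 'f) \<Rightarrow> bool" where
  "weak_star_null smul \<xi> \<longleftrightarrow>
     range \<xi> \<subseteq> dual smul \<and> limitin (weak_star smul) \<xi> 0 sequentially"


section \<open>Limited sets and the Gelfand--Phillips property\<close>

text \<open>
  The supremum of a family of nonnegative reals is taken in \<open>[0, \<infinity>)\<close>, so it is 0 for the empty family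
  (whereas \<^term>\<open>Sup {} :: real\<close> is unspecified).
\<close>

definition sup_norm_on :: "'b set \<Rightarrow> ('b \<Rightarrow> 'f::real_normed_vector) \<Rightarrow> real" where
  "sup_norm_on B f = (if B = {} then 0 else (SUP b\<in>B. norm (f b)))"

definition limited :: "('f::real_or_complex \<Rightarrow> 'a::banach \<Rightarrow> 'a) \<Rightarrow> 'a set \<Rightarrow> bool" where
  "limited smul B \<longleftrightarrow> bounded B \<and>
     (\<forall>\<xi>. weak_star_null smul \<xi> \<longrightarrow> (\<lambda>n. sup_norm_on B (blinfun_apply (\<xi> n))) \<longlonglongrightarrow> 0)"

definition gelfand_phillips :: "('f::real_or_complex \<Rightarrow> 'a::banach \<Rightarrow> 'a) \<Rightarrow> bool" where
  "gelfand_phillips smul \<longleftrightarrow> (\<forall>B. limited smul B \<longrightarrow> compact (closure B))"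


section \<open>Selective sequential pseudocompactness\<close>

definition selectively_seq_pseudocompact_at :: "'b topology \<Rightarrow> 'b set \<Rightarrow> bool" where
  "selectively_seq_pseudocompact_at Y A \<longleftrightarrow>
     (\<forall>U :: nat \<Rightarrow> 'b set. (\<forall>n. openin Y (U n) \<and> U n \<inter> A \<noteq> {}) \<longrightarrow>
        (\<exists>x. (\<forall>n. x n \<in> U n) \<and>
           (\<exists>r l. strict_mono (r :: nat \<Rightarrow> nat) \<and> limitin Y (x \<circ> r) l sequentially)))"

definition selectively_seq_pseudocompact :: "'b topology \<Rightarrow> bool" where
  "selectively_seq_pseudocompact Y \<longleftrightarrow> selectively_seq_pseudocompact_at Y (topspace Y)"


section \<open>Norming sets\<close>

definition norming :: "('f::real_or_complex \<Rightarrow> 'a::banach \<Rightarrow> 'a) \<Rightarrow> ('a \<Rightarrow>\<^sub>L 'f) set \<Rightarrow> bool" where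
  "norming smul S \<longleftrightarrow> S \<subseteq> dual smul \<and> bounded S \<and>
     (\<exists>C>0. \<forall>x. 1 / C * sup_norm_on S (\<lambda>\<xi>. blinfun_apply \<xi> x) \<le> norm x \<and>
                norm x \<le> C * sup_norm_on S (\<lambda>\<xi>. blinfun_apply \<xi> x))"


section \<open>Spaces of continuous functions and extension properties\<close>

text \<open>
  On a compact space every continuous function is bounded, so for compact \<open>'k\<close> the type
  \<open>'k \<Rightarrow>\<^sub>C 'f\<close> of bounded continuous functions with the supremum norm is \<open>C(K)\<close>. For the discrete
  space \<open>nat\<close> it is the space of bounded sequences, which contains \<open>c\<^sub>0\<close>.
\<close>

text \<open>
  The library proves completeness of \<open>'k \<Rightarrow>\<^sub>C 'f\<close> only for metric domains; the proof works for all
  topological spaces.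
\<close>

instance bcontfun :: (topological_space, complete_space) complete_space
proof
  fix f :: "nat \<Rightarrow> ('a, 'b) bcontfun"
  assume f: "Cauchy f"
  have "uniformly_Cauchy_on UNIV (\<lambda>n. apply_bcontfun (f n))"
    unfolding uniformly_Cauchy_on_def
    using f[unfolded Cauchy_def] by (metis dist_fun_lt_imp_dist_val_lt)
  then obtain g where "uniform_limit UNIV f g sequentially"
    using Cauchy_uniformly_convergent uniformly_convergent_on_def by blast
  from uniform_limit_bcontfunE[OF this sequentially_bot]
  obtain l' where "g = apply_bcontfun l'" "f \<longlonglongrightarrow> l'" by metis
  then show "convergent f"
    by (intro convergentI)
qed

instance bcontfun :: (topological_space, banach) banach ..

context includes bcontfun.lifting
begin

lift_definition scale_bcontfun ::
    "'f::real_or_complex \<Rightarrow> ('k::topological_space \<Rightarrow>\<^sub>C 'f) \<Rightarrow> ('k \<Rightarrow>\<^sub>C 'f)" is "\<lambda>c f x. c * f x"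
proof -
  fix c :: 'f and f :: "'k \<Rightarrow> 'f"
  assume f: "f \<in> bcontfun"
  then have "continuous_on UNIV (\<lambda>x. c * f x)"
    by (auto simp: bcontfun_def intro!: continuous_intros)
  moreover have "bounded (range (\<lambda>x. c * f x))"
    using bounded_linear_image[OF _ bounded_linear_mult_right, of "range f" c] f
    by (simp add: bcontfun_def image_image)
  ultimately show "(\<lambda>x. c * f x) \<in> bcontfun"
    by (simp add: bcontfun_def)
qed

lemma banach_over_scale_bcontfun:
  "banach_over (scale_bcontfun :: 'f::real_or_complex \<Rightarrow> ('k::topological_space \<Rightarrow>\<^sub>C 'f) \<Rightarrow> _)"
proof
  fix a b :: 'f and x y :: "'k \<Rightarrow>\<^sub>C 'f" and r :: real
  show "scale_bcontfun a (x + y) = scale_bcontfun a x + scale_bcontfun a y"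
    by transfer (simp add: distrib_left)
  show "scale_bcontfun (a + b) x = scale_bcontfun a x + scale_bcontfun b x"
    by transfer (simp add: distrib_right)
  show "scale_bcontfun a (scale_bcontfun b x) = scale_bcontfun (a * b) x"
    by transfer (simp add: mult.assoc)
  show "scale_bcontfun 1 x = x"
    by transfer simp
  show "scale_bcontfun (of_real r) x = r *\<^sub>R x"
    by transfer (simp add: scaleR_conv_of_real)
  have le: "norm (scale_bcontfun c z) \<le> norm c * norm z" for c :: 'f and z :: "'k \<Rightarrow>\<^sub>C 'f"
    by (rule norm_bound) (simp add: scale_bcontfun.rep_eq norm_mult mult_left_mono norm_bounded)
  show "norm (scale_bcontfun a x) = norm a * norm x"
  proof (cases "a = 0")
    case True
    then show ?thesis using le[of a x] by simp
  next
    case False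
    have "scale_bcontfun (inverse a) (scale_bcontfun a x) = x"
      using False by transfer (simp add: mult.assoc[symmetric])
    then have "norm x \<le> inverse (norm a) * norm (scale_bcontfun a x)"
      using le[of "inverse a" "scale_bcontfun a x"] by (simp add: norm_inverse)
    then have "norm a * norm x \<le> norm (scale_bcontfun a x)"
      using False by (simp add: field_simps)
    then show ?thesis using le[of a x] by simp
  qed
qed

end

definition c0 :: "(nat \<Rightarrow>\<^sub>C 'f::real_or_complex) set" where
  "c0 = {f. (\<lambda>n. apply_bcontfun f n) \<longlonglongrightarrow> 0}"

definition operator_on :: "('f::real_or_complex \<Rightarrow> 'a::banach \<Rightarrow> 'a) \<Rightarrow>
    ('f \<Rightarrow> 'b::real_normed_vector \<Rightarrow> 'b) \<Rightarrow> 'a set \<Rightarrow> ('a \<Rightarrow> 'b) \<Rightarrow> bool" where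
  "operator_on smul smul' X T \<longleftrightarrow>
     (\<forall>x\<in>X. \<forall>y\<in>X. T (x + y) = T x + T y) \<and>
     (\<forall>c. \<forall>x\<in>X. T (smul c x) = smul' c (T x)) \<and>
     (\<exists>C. \<forall>x\<in>X. norm (T x) \<le> C * norm x)"

definition separable_banach_subspace ::
    "('f::real_or_complex \<Rightarrow> 'a::banach \<Rightarrow> 'a) \<Rightarrow> 'a set \<Rightarrow> bool" where
  "separable_banach_subspace smul X \<longleftrightarrow>
     module.subspace smul X \<and> closed X \<and> separable_space (top_of_set X)"

definition separable_c0_extension_property ::
    "('f::real_or_complex \<Rightarrow> 'a::banach \<Rightarrow> 'a) \<Rightarrow> bool" where
  "separable_c0_extension_property smul \<longleftrightarrow>
     (\<forall>X T. separable_banach_subspace smul X \<and>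
            operator_on smul scale_bcontfun X T \<and> T ` X \<subseteq> c0 \<longrightarrow>
        (\<exists>T'. operator_on smul scale_bcontfun UNIV T' \<and> range T' \<subseteq> c0 \<and> (\<forall>x\<in>X. T' x = T x)))"

text \<open>
  The sequence \<open>\<xi>\<close> below is a weak* null sequence in the dual of the subspace \<open>X\<close>: a sequence of
  bounded functionals on \<open>X\<close> that converges to 0 pointwise on \<open>X\<close>.
\<close>

definition separably_weak_star_extensible ::
    "('f::real_or_complex \<Rightarrow> 'a::banach \<Rightarrow> 'a) \<Rightarrow> bool" where
  "separably_weak_star_extensible smul \<longleftrightarrow>
     (\<forall>X. \<forall>\<xi> :: nat \<Rightarrow> 'a \<Rightarrow> 'f. separable_banach_subspace smul X \<and>
            (\<forall>n. operator_on smul (*) X (\<xi> n)) \<and> (\<forall>x\<in>X. (\<lambda>n. \<xi> n x) \<longlonglongrightarrow> 0) \<longrightarrow>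
        (\<exists>r \<psi>. strict_mono (r :: nat \<Rightarrow> nat) \<and> weak_star_null smul \<psi> \<and>
           (\<forall>n. \<forall>x\<in>X. blinfun_apply (\<psi> n) x = \<xi> (r n) x)))"


section \<open>Probability measures\<close>

definition probability_functionals :: "(('k::t2_space \<Rightarrow>\<^sub>C 'f::real_or_complex) \<Rightarrow>\<^sub>L 'f) set" where
  "probability_functionals =
     {\<mu> \<in> dual scale_bcontfun. norm \<mu> = 1 \<and> blinfun_apply \<mu> (const_bcontfun 1) = 1}"

definition probability_topology ::
    "(('k::t2_space \<Rightarrow>\<^sub>C 'f::real_or_complex) \<Rightarrow>\<^sub>L 'f) topology" where
  "probability_topology = subtopology (weak_star scale_bcontfun) probability_functionals"

lift_definition dirac :: "'k::t2_space \<Rightarrow> ('k \<Rightarrow>\<^sub>C 'f::real_or_complex) \<Rightarrow>\<^sub>L 'f"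
  is "\<lambda>x f. apply_bcontfun f x"
  by (rule bounded_linear_intro[where K = 1])
    (auto simp: plus_bcontfun.rep_eq scaleR_bcontfun.rep_eq norm_bounded)

end

theory Submission
  imports Defs "HOL-Library.Diagonal_Subsequence"
begin

text \<open>
Let \<open>S\<close> be a bounded norming set of functionals and \<open>B\<close> a limited set. All conditions are used to
prove the same thing: every sequence in \<open>S\<close> has a subsequence that converges uniformly on any given
sequence \<open>b\<close> of points of \<open>B\<close>. This gives precompactness of \<open>B\<close>, because the restrictions of \<open>S\<close> to
\<open>b\<close> are then totally bounded in the sup-norm, and total boundedness passes from the functionals on
the points to the points on the functionals
(\<open>compact_closure_if_uniformly_convergent_subsequences\<close>).

Uniform convergence comes from limitedness, which says that a weak* convergent sequence of
functionals converges uniformly on \<open>B\<close>; the conditions differ in how they provide a weak* convergent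
sequence.

Under condition (iv), weak* convergence is only available for some selection from given open sets.
A given sequence in \<open>S\<close> is first thinned out to converge pointwise on \<open>b\<close>, and then the open sets are
chosen so that the selection witnesses how far the sequence is from its pointwise limit
(\<open>ssp_imp_uniformly_convergent_subsequence\<close>). Condition (i) is the case where \<open>S\<close> is the dual unit
ball, which is norming by the Hahn--Banach theorem (\<open>supporting_functional\<close>). For (v) and (vi), the
Dirac functionals, or any larger set of probability functionals, are norming.

Under conditions (ii) and (iii), a sequence in the dual unit ball converges, after thinning out, on a
closed separable subspace that contains \<open>b\<close>; a subsequence of the differences to the limit then
extends to a weak* null sequence on the whole space
(\<open>gelfand_phillips_if_weak_star_null_extensions\<close>). The separable
\<open>c\<^sub>0\<close>-extension property provides such extensions because a weak* null sequence amounts to an operator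
into \<open>c\<^sub>0\<close>.
\<close>

section \<open>Scalars and suprema of norms\<close>

text \<open>
The embedding of the scalars into the complex numbers is automatically the identity on real scalars:
a complex number whose distances to \<open>0\<close> and to \<open>1\<close> are \<open>\<bar>r\<bar>\<close> and \<open>\<bar>r - 1\<bar>\<close> can only be \<open>r\<close>.
It carries Bolzano--Weierstrass, separability and the decomposition into real and imaginary parts
over to the abstract scalar field.
\<close>

lemma scalar_embedding:
  obtains \<phi> :: "'f::real_or_complex \<Rightarrow> complex"
  where "\<And>x y. \<phi> (x + y) = \<phi> x + \<phi> y" "\<And>x y. \<phi> (x * y) = \<phi> x * \<phi> y"
    "\<And>x. norm (\<phi> x) = norm x" "\<And>r. \<phi> (of_real r) = of_real r"
    "range \<phi> = \<real> \<or> range \<phi> = UNIV" "\<And>x y. dist (\<phi> x) (\<phi> y) = dist x y" "inj \<phi>"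
proof -
  obtain \<phi> :: "'f \<Rightarrow> complex" where
    add: "\<And>x y. \<phi> (x + y) = \<phi> x + \<phi> y" and mult: "\<And>x y. \<phi> (x * y) = \<phi> x * \<phi> y"
    and norm: "\<And>x. norm (\<phi> x) = norm x" and range: "range \<phi> = \<real> \<or> range \<phi> = UNIV"
    using real_or_complex[where 'a='f] by blast
  have diff: "\<phi> (x - y) = \<phi> x - \<phi> y" for x y
    using add[of "x - y" y] by (simp add: algebra_simps)
  have one: "\<phi> 1 = 1"
  proof -
    have "\<phi> 1 \<noteq> 0" using norm[of 1] by auto
    then show ?thesis using mult[of 1 1] by simp
  qed
  have real: "\<phi> (of_real r) = of_real r" for r
  proof -
    let ?z = "\<phi> (of_real r)"
    have 1: "norm ?z = \<bar>r\<bar>" by (simp add: norm)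
    have "norm (?z - 1) = norm (of_real (r - 1) :: 'f)"
      by (metis diff norm of_real_1 of_real_diff one)
    then have 2: "norm (?z - 1) = \<bar>r - 1\<bar>" by (simp only: norm_of_real)
    have a: "(Re ?z)\<^sup>2 + (Im ?z)\<^sup>2 = r\<^sup>2"
      using 1 by (metis cmod_power2 power2_abs)
    have b: "(Re ?z - 1)\<^sup>2 + (Im ?z)\<^sup>2 = (r - 1)\<^sup>2"
      using 2 cmod_power2[of "?z - 1"] by simp
    \<comment> \<open>Subtracting the two equations leaves a linear equation for the real part.\<close>
    have "Re ?z = r" using a b by (simp add: power2_eq_square algebra_simps)
    with a have "Im ?z = 0" by simp
    with \<open>Re ?z = r\<close> show ?thesis by (simp add: complex_eq_iff)
  qed
  have dist: "dist (\<phi> x) (\<phi> y) = dist x y" for x y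
    by (metis diff dist_norm norm)
  then have "inj \<phi>" by (metis dist_eq_0_iff injI)
  with that add mult norm real range dist show thesis by blast
qed

lemma bounded_scalars_convergent_subsequence:
  fixes s :: "nat \<Rightarrow> 'f::real_or_complex"
  assumes "bounded (range s)"
  shows "\<exists>r. strict_mono (r :: nat \<Rightarrow> nat) \<and> convergent (s \<circ> r)"
proof -
  obtain \<phi> :: "'f \<Rightarrow> complex" where norm: "\<And>x. norm (\<phi> x) = norm x"
    and dist: "\<And>x y. dist (\<phi> x) (\<phi> y) = dist x y"
    using scalar_embedding by metis
  have "bounded (range (\<phi> \<circ> s))"
    using assms unfolding bounded_iff by (auto simp: norm)
  then obtain l r where r: "strict_mono (r :: nat \<Rightarrow> nat)" "((\<phi> \<circ> s) \<circ> r) \<longlonglongrightarrow> l"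
    using bounded_imp_convergent_subsequence by blast
  then have "Cauchy (\<phi> \<circ> (s \<circ> r))" by (metis LIMSEQ_imp_Cauchy comp_assoc)
  then have "Cauchy (s \<circ> r)" by (simp add: Cauchy_def dist)
  with r show ?thesis by (auto simp: Cauchy_convergent_iff)
qed

lemma diagonal_convergent_subsequence:
  fixes f :: "nat \<Rightarrow> 'c \<Rightarrow> 'f::real_or_complex"
  assumes "countable D" and bdd: "\<And>x. x \<in> D \<Longrightarrow> bounded (range (\<lambda>n. f n x))"
  shows "\<exists>r. strict_mono (r :: nat \<Rightarrow> nat) \<and> (\<forall>x\<in>D. convergent (\<lambda>n. f (r n) x))"
proof (cases "D = {}")
  case True
  then show ?thesis using strict_mono_id by blast
next
  case False
  let ?P = "\<lambda>j s. convergent (\<lambda>n. f (s n) (from_nat_into D j))"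
  interpret subseqs ?P
  proof
    fix j and s :: "nat \<Rightarrow> nat"
    have "bounded (range (\<lambda>n. f (s n) (from_nat_into D j)))"
      by (rule bounded_subset[OF bdd[OF from_nat_into[OF False, of j]]]) auto
    from bounded_scalars_convergent_subsequence[OF this]
    show "\<exists>r'. strict_mono r' \<and> ?P j (s \<circ> r')" by (simp add: o_def)
  qed
  have "convergent (\<lambda>n. f (diagseq n) x)" if "x \<in> D" for x
  proof -
    obtain j where j: "from_nat_into D j = x"
      using \<open>countable D\<close> \<open>x \<in> D\<close> by (meson from_nat_into_surj)
    have "?P j (diagseq \<circ> ((+) (Suc j)))"
    proof (rule diagseq_holds)
      fix r s :: "nat \<Rightarrow> nat" and n
      assume "strict_mono r" "?P n s"
      then show "?P n (s \<circ> r)"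
        using convergent_subseq_convergent[of "\<lambda>k. f (s k) (from_nat_into D n)" r] by (simp add: o_def)
    qed
    then have "convergent (\<lambda>n. f (diagseq (n + Suc j)) x)"
      by (simp add: o_def j add.commute)
    then show ?thesis
      using convergent_ignore_initial_segment[of "\<lambda>n. f (diagseq n) x" "Suc j"] by simp
  qed
  with subseq_diagseq show ?thesis by blast
qed

lemma countable_dense_scalars:
  "\<exists>Q :: 'f::real_or_complex set. countable Q \<and> closure Q = UNIV"
proof -
  obtain \<phi> :: "'f \<Rightarrow> complex" where
    dist: "\<And>x y. dist (\<phi> x) (\<phi> y) = dist x y" and "inj \<phi>"
    using scalar_embedding by metis
  obtain T where T: "countable T" "T \<subseteq> range \<phi>" "range \<phi> \<subseteq> closure T"
    using separable by blast
  have "x \<in> closure (\<phi> -` T)" for x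
  proof -
    have "\<phi> x \<in> closure T" using T by blast
    then show ?thesis
      using T(2) unfolding closure_approachable
      by (metis dist imageE subsetD vimageI)
  qed
  moreover have "countable (\<phi> -` T)"
    using countable_image_inj_on[of \<phi> "\<phi> -` T"] T(1) \<open>inj \<phi>\<close>
    by (meson countable_subset image_vimage_subset inj_on_subset subset_UNIV)
  ultimately show ?thesis by blast
qed

lemma sup_norm_on_le:
  assumes "\<And>b. b \<in> B \<Longrightarrow> norm (f b) \<le> C" "C \<ge> 0"
  shows "sup_norm_on B f \<le> C"
  using assms by (auto simp: sup_norm_on_def intro!: cSUP_least)

lemma norm_le_sup_norm_on:
  assumes "bounded (f ` B)" "b \<in> B"
  shows "norm (f b) \<le> sup_norm_on B f"
proof -
  have "bdd_above ((\<lambda>b. norm (f b)) ` B)"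
    using assms(1) unfolding bounded_iff bdd_above_def by auto
  then show ?thesis using assms(2) by (auto simp: sup_norm_on_def intro!: cSUP_upper)
qed

lemma bounded_blinfun_image:
  "bounded B \<Longrightarrow> bounded (blinfun_apply \<xi> ` B)"
  by (rule bounded_linear_image[OF _ blinfun.bounded_linear_right])

lemma bounded_evaluation_image:
  "bounded S \<Longrightarrow> bounded ((\<lambda>\<xi>. blinfun_apply \<xi> x) ` S)"
  by (rule bounded_linear_image[OF _ blinfun.bounded_linear_left])

section \<open>Weak* convergence and limited sets\<close>

text \<open>
The strong operator topology is pulled back from the product topology, so its limits are pointwise.
\<close>

lemma limitin_strong_operator_topology:
  "limitin strong_operator_topology \<xi> l F \<longleftrightarrow> (\<forall>x. ((\<lambda>n. blinfun_apply (\<xi> n) x) \<longlongrightarrow> blinfun_apply l x) F)"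
    (is "?L \<longleftrightarrow> ?R")
proof
  assume ?L
  then have "limitin euclidean ((\<lambda>f. blinfun_apply f x) \<circ> \<xi>) (blinfun_apply l x) F" for x
    by (rule continuous_map_limit[OF strong_operator_topology_continuous_evaluation])
  then show ?R by (simp add: o_def)
next
  assume R: ?R
  then have lim: "((\<lambda>n. blinfun_apply (\<xi> n)) \<longlongrightarrow> blinfun_apply l) F"
    using limitin_componentwise[of "\<lambda>_. euclidean" UNIV "\<lambda>n. blinfun_apply (\<xi> n)" "blinfun_apply l" F]
    by (simp add: euclidean_product_topology)
  show ?L
    unfolding limitin_def
  proof (intro conjI allI impI)
    fix U assume "openin strong_operator_topology U \<and> l \<in> U"
    then obtain V where "open V" "U = blinfun_apply -` V" "blinfun_apply l \<in> V"
      by (auto simp: strong_operator_topology_def openin_pullback_topology)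
    then show "eventually (\<lambda>n. \<xi> n \<in> U) F"
      using lim by (auto simp: tendsto_def)
  qed (simp add: strong_operator_topology_topspace)
qed

lemma limitin_weak_star:
  assumes "range \<xi> \<subseteq> dual smul"
  shows "limitin (weak_star smul) \<xi> l sequentially \<longleftrightarrow>
    l \<in> dual smul \<and> (\<forall>x. (\<lambda>n. blinfun_apply (\<xi> n) x) \<longlonglongrightarrow> blinfun_apply l x)"
  using assms by (auto simp: weak_star_def limitin_subtopology limitin_strong_operator_topology
      image_subset_iff)

lemma topspace_weak_star [simp]: "topspace (weak_star smul) = dual smul"
  by (simp add: weak_star_def strong_operator_topology_topspace)

lemma dual_zero: "0 \<in> dual smul"
  by (simp add: dual_def)

lemma dual_diff: "\<xi> \<in> dual smul \<Longrightarrow> \<eta> \<in> dual smul \<Longrightarrow> \<xi> - \<eta> \<in> dual smul"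
  by (simp add: dual_def blinfun.diff_left algebra_simps)

lemma weak_star_null_iff:
  "weak_star_null smul \<xi> \<longleftrightarrow> range \<xi> \<subseteq> dual smul \<and> (\<forall>x. (\<lambda>n. blinfun_apply (\<xi> n) x) \<longlonglongrightarrow> 0)"
  by (auto simp: weak_star_null_def limitin_weak_star dual_zero)

lemma limited_uniform_limit_zero:
  assumes "limited smul B" "weak_star_null smul \<psi>"
  shows "uniform_limit B (\<lambda>n. blinfun_apply (\<psi> n)) (\<lambda>_. 0) sequentially"
proof (rule uniform_limitI)
  fix e :: real assume "e > 0"
  have "(\<lambda>n. sup_norm_on B (blinfun_apply (\<psi> n))) \<longlonglongrightarrow> 0"
    using assms by (auto simp: limited_def)
  then have "eventually (\<lambda>n. sup_norm_on B (blinfun_apply (\<psi> n)) < e) sequentially"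
    using \<open>e > 0\<close> by (rule order_tendstoD)
  then show "eventually (\<lambda>n. \<forall>x\<in>B. dist (blinfun_apply (\<psi> n) x) 0 < e) sequentially"
  proof (rule eventually_mono, intro ballI)
    fix n x assume "sup_norm_on B (blinfun_apply (\<psi> n)) < e" "x \<in> B"
    moreover have "norm (blinfun_apply (\<psi> n) x) \<le> sup_norm_on B (blinfun_apply (\<psi> n))"
      by (rule norm_le_sup_norm_on) (use assms \<open>x \<in> B\<close> in \<open>auto simp: limited_def bounded_blinfun_image\<close>)
    ultimately show "dist (blinfun_apply (\<psi> n) x) 0 < e" by simp
  qed
qed

text \<open>
The form in which limitedness is used: the differences to the limit form a weak* null sequence, so
weak* convergence is uniform on a limited set.
\<close>

lemma limited_uniform_limit:
  assumes "limited smul B" "range \<psi> \<subseteq> dual smul" "limitin (weak_star smul) \<psi> \<eta> sequentially"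
  shows "uniform_limit B (\<lambda>n. blinfun_apply (\<psi> n)) (blinfun_apply \<eta>) sequentially"
proof -
  have "weak_star_null smul (\<lambda>n. \<psi> n - \<eta>)"
    unfolding weak_star_null_iff
  proof (intro conjI allI)
    show "range (\<lambda>n. \<psi> n - \<eta>) \<subseteq> dual smul"
      using assms(2,3) by (auto simp: limitin_weak_star[OF assms(2)] intro!: dual_diff)
    show "(\<lambda>n. blinfun_apply (\<psi> n - \<eta>) x) \<longlonglongrightarrow> 0" for x
      using assms(3) unfolding limitin_weak_star[OF assms(2)] blinfun.diff_left
      by (intro LIM_zero) blast
  qed
  from limited_uniform_limit_zero[OF assms(1) this]
  show ?thesis
    by (simp add: uniform_limit_iff blinfun.diff_left dist_norm)
qed

section \<open>Precompactness through uniformly convergent functionals\<close>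

text \<open>
Selective sequential pseudocompactness does not yield limits of a given sequence in \<open>S\<close>, only limits
of some sequence \<open>\<psi>\<close> taken from prescribed neighbourhoods; and a weak* neighbourhood of \<open>\<zeta> n\<close>
controls \<open>\<psi> n\<close> at finitely many points only. This suffices if the points are well chosen. A diagonal
subsequence \<open>\<zeta>\<close> of the given sequence converges pointwise on the countable set \<open>range b\<close> to a
function \<open>g\<close>. As \<open>g\<close> is known before the neighbourhoods are chosen, the \<open>n\<close>-th of them can test the
point at which \<open>\<zeta> n\<close> is nearly farthest from \<open>g\<close>, besides the points \<open>b 0, \<dots>, b n\<close>, which force the
weak* limit of \<open>\<psi>\<close> to agree with \<open>g\<close> on \<open>range b\<close>. Since \<open>\<psi>\<close> converges uniformly on \<open>B\<close>, the distance
from \<open>\<zeta> n\<close> to \<open>g\<close> is small at its worst point, hence everywhere on \<open>range b\<close>.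
\<close>

lemma ssp_imp_uniformly_convergent_subsequence:
  fixes smul :: "'f::real_or_complex \<Rightarrow> 'a::banach \<Rightarrow> 'a" and b :: "nat \<Rightarrow> 'a"
  assumes ssp: "selectively_seq_pseudocompact_at (weak_star smul) S"
    and S: "S \<subseteq> dual smul" "bounded S" and B: "limited smul B" "range b \<subseteq> B"
    and \<eta>: "range \<eta> \<subseteq> S"
  shows "\<exists>r. strict_mono (r :: nat \<Rightarrow> nat) \<and>
    uniformly_convergent_on (range b) (\<lambda>n. blinfun_apply (\<eta> (r n)))"
proof -
  have "bounded (range (\<lambda>n. blinfun_apply (\<eta> n) x))" for x
    by (rule bounded_subset[OF bounded_evaluation_image[OF S(2), of x]]) (use \<eta> in auto)
  then obtain s where s: "strict_mono s" "\<And>x. x \<in> range b \<Longrightarrow> convergent (\<lambda>n. blinfun_apply (\<eta> (s n)) x)"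
    using diagonal_convergent_subsequence[of "range b" "\<lambda>n. blinfun_apply (\<eta> n)"] by blast
  define \<zeta> where "\<zeta> n = \<eta> (s n)" for n
  define g where "g x = lim (\<lambda>n. blinfun_apply (\<zeta> n) x)" for x
  have g: "(\<lambda>n. blinfun_apply (\<zeta> n) (b j)) \<longlonglongrightarrow> g (b j)" for j
    using s(2) by (simp add: g_def \<zeta>_def convergent_LIMSEQ_iff)
  have \<zeta>S: "\<zeta> n \<in> S" for n using \<eta> by (auto simp: \<zeta>_def)
  have "bounded B" using B(1) by (simp add: limited_def)
  obtain M where M: "\<And>\<xi> x. \<xi> \<in> S \<Longrightarrow> x \<in> B \<Longrightarrow> norm (blinfun_apply \<xi> x) \<le> M"
  proof -
    obtain M1 M2 where "\<And>\<xi>. \<xi> \<in> S \<Longrightarrow> norm \<xi> \<le> M1" "\<And>x. x \<in> B \<Longrightarrow> norm x \<le> M2"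
      using \<open>bounded S\<close> \<open>bounded B\<close> by (meson bounded_iff)
    then show thesis
      by (intro that[of "M1 * M2"]) (meson norm_blinfun mult_mono norm_ge_zero order_trans)
  qed
  have bB: "b j \<in> B" for j using B(2) by auto
  have gM: "norm (g (b j)) \<le> M" for j
    using g[of j] by (rule LIMSEQ_le_const2[OF tendsto_norm]) (auto intro: M \<zeta>S bB)
  define e where "e n = inverse (real (Suc n))" for n
  have e_pos: "e n > 0" for n by (simp add: e_def)
  \<comment> \<open>The supremum of the distances need not be attained, hence the slack \<open>e n\<close>.\<close>
  have "\<exists>j. \<forall>i. dist (blinfun_apply (\<zeta> n) (b i)) (g (b i)) \<le> dist (blinfun_apply (\<zeta> n) (b j)) (g (b j)) + e n" for n
  proof -
    let ?d = "\<lambda>i. dist (blinfun_apply (\<zeta> n) (b i)) (g (b i))"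
    have "?d i \<le> M + M" for i
      unfolding dist_norm by (intro order_trans[OF norm_triangle_ineq4] add_mono M \<zeta>S bB gM)
    then have bdd: "bdd_above (range ?d)" by (auto simp: bdd_above_def)
    have "Sup (range ?d) - e n < Sup (range ?d)" using e_pos by simp
    then obtain j where "Sup (range ?d) - e n < ?d j"
      using less_cSUP_iff[OF _ bdd] by auto
    moreover have "?d i \<le> Sup (range ?d)" for i using bdd by (auto intro: cSUP_upper)
    ultimately show ?thesis by (intro exI[of _ j] allI) (smt (verit))
  qed
  then obtain j where j: "\<And>n i. dist (blinfun_apply (\<zeta> n) (b i)) (g (b i)) \<le> dist (blinfun_apply (\<zeta> n) (b (j n))) (g (b (j n))) + e n"
    by metis
  define U where "U n = dual smul \<inter> {\<xi>. \<forall>i\<in>insert (j n) {..n}. blinfun_apply \<xi> (b i) \<in> ball (blinfun_apply (\<zeta> n) (b i)) (e n)}" for n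
  have "openin (weak_star smul) (U n)" for n
    unfolding U_def weak_star_def Int_commute[of "dual smul"]
    by (intro openin_subtopology_Int strong_operator_topology_basis) auto
  moreover have "\<zeta> n \<in> U n \<inter> S" for n
    using \<zeta>S[of n] S(1) e_pos by (auto simp: U_def)
  ultimately obtain \<psi> t \<eta>' where \<psi>: "\<And>n. \<psi> n \<in> U n" and t: "strict_mono t"
    and lim: "limitin (weak_star smul) (\<psi> \<circ> t) \<eta>' sequentially"
    using ssp unfolding selectively_seq_pseudocompact_at_def by (metis empty_iff)
  have \<psi>_dual: "range (\<psi> \<circ> t) \<subseteq> dual smul" using \<psi> by (auto simp: U_def)
  have near: "dist (blinfun_apply (\<zeta> n) (b i)) (blinfun_apply (\<psi> n) (b i)) < e n" if "i \<le> n \<or> i = j n" for n i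
    using \<psi>[of n] that by (auto simp: U_def)
  have e0: "e \<longlonglongrightarrow> 0" unfolding e_def by (rule LIMSEQ_inverse_real_of_nat)
  have et: "(\<lambda>n. e (t n)) \<longlonglongrightarrow> 0" using LIMSEQ_subseq_LIMSEQ[OF e0 t] by (simp add: o_def)
  have eq: "blinfun_apply \<eta>' (b i) = g (b i)" for i
  proof (rule LIMSEQ_unique)
    have 1: "(\<lambda>n. blinfun_apply (\<psi> (t n)) (b i)) \<longlonglongrightarrow> blinfun_apply \<eta>' (b i)"
      using lim limitin_weak_star[OF \<psi>_dual] by simp
    have "(\<lambda>n. blinfun_apply (\<zeta> (t n)) (b i) - blinfun_apply (\<psi> (t n)) (b i)) \<longlonglongrightarrow> 0"
    proof (rule Lim_null_comparison[OF _ et])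
      show "eventually (\<lambda>n. norm (blinfun_apply (\<zeta> (t n)) (b i) - blinfun_apply (\<psi> (t n)) (b i)) \<le> e (t n)) sequentially"
        using eventually_ge_at_top[of i]
      proof eventually_elim
        case (elim n)
        then have "i \<le> t n" using seq_suble[OF t, of n] by linarith
        then show ?case using near[of i "t n"] by (simp add: dist_norm)
      qed
    qed
    from tendsto_add[OF this 1]
    show "(\<lambda>n. blinfun_apply (\<zeta> (t n)) (b i)) \<longlonglongrightarrow> blinfun_apply \<eta>' (b i)" by simp
    show "(\<lambda>n. blinfun_apply (\<zeta> (t n)) (b i)) \<longlonglongrightarrow> g (b i)"
      using LIMSEQ_subseq_LIMSEQ[OF g t] by (simp add: o_def)
  qed
  have "uniform_limit (range b) (\<lambda>n. blinfun_apply (\<zeta> (t n))) g sequentially"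
  proof (rule uniform_limitI)
    fix \<epsilon> :: real assume "\<epsilon> > 0"
    have "eventually (\<lambda>n. \<forall>x\<in>B. dist (blinfun_apply ((\<psi> \<circ> t) n) x) (blinfun_apply \<eta>' x) < \<epsilon> / 2) sequentially"
      using \<open>\<epsilon> > 0\<close> by (intro uniform_limitD[OF limited_uniform_limit[OF B(1) \<psi>_dual lim]]) simp
    moreover have "eventually (\<lambda>n. e (t n) < \<epsilon> / 4) sequentially"
      using et \<open>\<epsilon> > 0\<close> by (intro order_tendstoD) auto
    ultimately show "eventually (\<lambda>n. \<forall>x\<in>range b. dist (blinfun_apply (\<zeta> (t n)) x) (g x) < \<epsilon>) sequentially"
    proof eventually_elim
      case (elim n)
      let ?j = "j (t n)"
      have "dist (blinfun_apply (\<zeta> (t n)) (b i)) (g (b i)) < \<epsilon>" for i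
      proof -
        have "dist (blinfun_apply (\<zeta> (t n)) (b ?j)) (g (b ?j)) <
            e (t n) + \<epsilon> / 2"
          using near[of ?j "t n"] elim(1) bB[of ?j] eq[of ?j]
            dist_triangle[of "blinfun_apply (\<zeta> (t n)) (b ?j)" "g (b ?j)" "blinfun_apply (\<psi> (t n)) (b ?j)"]
          by fastforce
        then show ?thesis using j[of "t n" i] elim(2) by simp
      qed
      then show ?case by blast
    qed
  qed
  then have "uniformly_convergent_on (range b) (\<lambda>n. blinfun_apply (\<eta> ((s \<circ> t) n)))"
    by (auto simp: uniformly_convergent_on_def \<zeta>_def)
  then show ?thesis using strict_mono_o[OF s(1) t] by blast
qed

text \<open>
The duality of total boundedness, as in Schauder's theorem on adjoints of compact operators. For a
sequence \<open>b\<close> in \<open>B\<close>, the hypothesis makes the restrictions of \<open>S\<close> to \<open>b\<close> totally bounded in the space of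
bounded sequences. Countably many bounded sequences therefore approximate all these restrictions,
and along a diagonal subsequence of the indices they all converge. Along it the values \<open>\<xi> (b n)\<close> are
Cauchy uniformly in \<open>\<xi> \<in> S\<close>, and because \<open>S\<close> is norming, \<open>b\<close> is Cauchy along it.
\<close>

lemma compact_closure_if_uniformly_convergent_subsequences:
  fixes S :: "('a::banach \<Rightarrow>\<^sub>L 'f::real_or_complex) set"
  assumes "C > 0" and norming: "\<And>x. norm x \<le> C * sup_norm_on S (\<lambda>\<xi>. blinfun_apply \<xi> x)"
    and "bounded B"
    and conv: "\<And>b \<eta>. range b \<subseteq> B \<Longrightarrow> range \<eta> \<subseteq> S \<Longrightarrow>
      \<exists>r. strict_mono (r :: nat \<Rightarrow> nat) \<and> uniformly_convergent_on (range (b :: nat \<Rightarrow> 'a)) (\<lambda>n. blinfun_apply (\<eta> (r n)))"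
  shows "compact (closure B)"
proof -
  have "\<exists>r. strict_mono r \<and> Cauchy (b \<circ> r)" if b: "range b \<subseteq> B" for b :: "nat \<Rightarrow> 'a"
  proof -
    define F :: "('a \<Rightarrow>\<^sub>L 'f) \<Rightarrow> (nat \<Rightarrow>\<^sub>C 'f)" where "F \<xi> = Bcontfun (\<lambda>j. blinfun_apply \<xi> (b j))" for \<xi>
    have F: "apply_bcontfun (F \<xi>) j = blinfun_apply \<xi> (b j)" for \<xi> j
    proof -
      have "bounded (range (\<lambda>j. blinfun_apply \<xi> (b j)))"
        by (rule bounded_subset[OF bounded_blinfun_image[OF \<open>bounded B\<close>]]) (use b in auto)
      then have "(\<lambda>j. blinfun_apply \<xi> (b j)) \<in> bcontfun"
        by (simp add: bcontfun_def)
      then show ?thesis by (simp add: F_def Bcontfun_inverse)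
    qed
    have "Met_TC.mtotally_bounded (F ` S)"
      unfolding Met_TC.mtotally_bounded_sequentially MCauchy_iff_Cauchy
    proof (intro conjI allI impI)
      fix \<sigma> :: "nat \<Rightarrow> nat \<Rightarrow>\<^sub>C 'f" assume "range \<sigma> \<subseteq> F ` S"
      then have "\<forall>n. \<exists>\<xi>. \<xi> \<in> S \<and> \<sigma> n = F \<xi>" by blast
      then obtain \<eta> where \<eta>: "\<And>n. \<eta> n \<in> S" "\<And>n. \<sigma> n = F (\<eta> n)" by metis
      obtain r :: "nat \<Rightarrow> nat" where r: "strict_mono r" "uniformly_convergent_on (range b) (\<lambda>n. blinfun_apply (\<eta> (r n)))"
        using conv[OF b, of \<eta>] \<eta>(1) by blast
      have "Cauchy (\<sigma> \<circ> r)"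
        unfolding Cauchy_def
      proof (intro allI impI)
        fix e :: real assume "e > 0"
        then obtain N where N: "\<forall>x\<in>range b. \<forall>m\<ge>N. \<forall>n\<ge>N. dist (blinfun_apply (\<eta> (r m)) x) (blinfun_apply (\<eta> (r n)) x) < e/2"
          using uniformly_convergent_Cauchy[OF r(2)] unfolding uniformly_Cauchy_on_def by (metis half_gt_zero)
        have "dist ((\<sigma> \<circ> r) m) ((\<sigma> \<circ> r) n) \<le> e/2" if "m \<ge> N" "n \<ge> N" for m n
          by (rule dist_bound) (use N that in \<open>simp add: F \<eta>(2) less_imp_le\<close>)
        then show "\<exists>N. \<forall>m\<ge>N. \<forall>n\<ge>N. dist ((\<sigma> \<circ> r) m) ((\<sigma> \<circ> r) n) < e"
          using \<open>e > 0\<close> by (smt (verit) field_sum_of_halves)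
      qed
      with r(1) show "\<exists>r. strict_mono r \<and> Cauchy (\<sigma> \<circ> r)" by blast
    qed auto
    then have net: "\<exists>K. finite K \<and> K \<subseteq> F ` S \<and> F ` S \<subseteq> (\<Union>g\<in>K. ball g e)" if "e > 0" for e
      using that unfolding Met_TC.mtotally_bounded_def by simp
    have "\<forall>k. \<exists>K. finite K \<and> F ` S \<subseteq> (\<Union>g\<in>K. ball g (inverse (real (Suc k))))"
      using net by (meson inverse_positive_iff_positive of_nat_0_less_iff zero_less_Suc)
    then obtain K where K: "\<And>k. finite (K k)" "\<And>k. F ` S \<subseteq> (\<Union>g\<in>K k. ball g (inverse (real (Suc k))))"
      by metis
    have "countable (\<Union>k. K k)" using K(1) by (simp add: uncountable_infinite countable_finite)
    moreover have "bounded (range (\<lambda>n. apply_bcontfun g n))" for g :: "nat \<Rightarrow>\<^sub>C 'f"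
      using bounded_apply_bcontfun .
    ultimately obtain r :: "nat \<Rightarrow> nat" where r: "strict_mono r"
      "\<And>g. g \<in> (\<Union>k. K k) \<Longrightarrow> convergent (\<lambda>n. apply_bcontfun g (r n))"
      using diagonal_convergent_subsequence[of "\<Union>k. K k" "\<lambda>n g. apply_bcontfun g n"] by blast
    have "Cauchy (b \<circ> r)"
      unfolding Cauchy_def
    proof (intro allI impI)
      fix e :: real assume "e > 0"
      \<comment> \<open>Three errors of size \<open>d\<close>, multiplied by the norming constant, have to stay below \<open>e\<close>.\<close>
      define d where "d = e / (4 * C)"
      have "d > 0" using \<open>e > 0\<close> \<open>C > 0\<close> by (simp add: d_def)
      obtain k where k: "inverse (real (Suc k)) < d" using reals_Archimedean[OF \<open>d > 0\<close>] by blast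
      have "eventually (\<lambda>N. \<forall>g\<in>K k. \<forall>m\<ge>N. \<forall>n\<ge>N. dist (apply_bcontfun g (r m)) (apply_bcontfun g (r n)) < d) sequentially"
      proof (subst eventually_ball_finite_distrib[OF K(1)], intro ballI)
        fix g assume "g \<in> K k"
        then have "Cauchy (\<lambda>n. apply_bcontfun g (r n))" using r(2) by (auto intro: convergent_Cauchy)
        then obtain N0 where "\<forall>m\<ge>N0. \<forall>n\<ge>N0. dist (apply_bcontfun g (r m)) (apply_bcontfun g (r n)) < d"
          using \<open>d > 0\<close> unfolding Cauchy_def by blast
        then show "eventually (\<lambda>N. \<forall>m\<ge>N. \<forall>n\<ge>N. dist (apply_bcontfun g (r m)) (apply_bcontfun g (r n)) < d) sequentially"
          unfolding eventually_sequentially by (metis order_trans)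
      qed
      then obtain N where N: "\<And>g m n. g \<in> K k \<Longrightarrow> m \<ge> N \<Longrightarrow> n \<ge> N \<Longrightarrow>
          dist (apply_bcontfun g (r m)) (apply_bcontfun g (r n)) < d"
        unfolding eventually_sequentially by blast
      have "dist ((b \<circ> r) m) ((b \<circ> r) n) < e" if mn: "m \<ge> N" "n \<ge> N" for m n
      proof -
        have "norm (blinfun_apply \<xi> (b (r m) - b (r n))) \<le> 3 * d" if "\<xi> \<in> S" for \<xi>
        proof -
          obtain g where g: "g \<in> K k" "dist g (F \<xi>) < d"
            using K(2)[of k] \<open>\<xi> \<in> S\<close> k by fastforce
          have "dist (apply_bcontfun g i) (blinfun_apply \<xi> (b i)) < d" for i
            using dist_bounded[of g i "F \<xi>"] g(2) by (simp add: F)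
          from this[of "r m"] this[of "r n"] N[OF g(1) mn]
          have "dist (blinfun_apply \<xi> (b (r m))) (blinfun_apply \<xi> (b (r n))) < 3 * d"
            by (smt (verit) dist_commute dist_triangle)
          then show ?thesis by (simp add: dist_norm blinfun.diff_right)
        qed
        then have "sup_norm_on S (\<lambda>\<xi>. blinfun_apply \<xi> (b (r m) - b (r n))) \<le> 3 * d" (is "?s \<le> _")
          using \<open>d > 0\<close> by (intro sup_norm_on_le) auto
        then have "C * ?s \<le> C * (3 * d)" using \<open>C > 0\<close> by simp
        also have "\<dots> < e" using \<open>e > 0\<close> \<open>C > 0\<close> by (simp add: d_def)
        finally show ?thesis using norming[of "b (r m) - b (r n)"] by (simp add: dist_norm)
      qed
      then show "\<exists>N. \<forall>m\<ge>N. \<forall>n\<ge>N. dist ((b \<circ> r) m) ((b \<circ> r) n) < e" by blast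
    qed
    with r(1) show ?thesis by blast
  qed
  then have "Met_TC.mtotally_bounded B"
    unfolding Met_TC.mtotally_bounded_sequentially MCauchy_iff_Cauchy by simp
  then show ?thesis
    by (simp add: Met_TC.mtotally_bounded_eq_compact_closure_of complete_UNIV)
qed

section \<open>Supporting functionals\<close>

definition sublinear :: "('a::real_vector \<Rightarrow> real) \<Rightarrow> bool" where
  "sublinear p \<longleftrightarrow> (\<forall>x y. p (x + y) \<le> p x + p y) \<and> (\<forall>t\<ge>0. \<forall>x. p (t *\<^sub>R x) = t * p x)"

text \<open>
Positive homogeneity needs only one inequality, which can be applied to \<open>t\<close> and to \<open>1 / t\<close>.
\<close>

lemma sublinearI:
  assumes add: "\<And>x y. p (x + y) \<le> p x + p y"
    and scale: "\<And>t x. t > 0 \<Longrightarrow> p (t *\<^sub>R x) \<le> t * p x" and zero: "p 0 = 0"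
  shows "sublinear p"
  unfolding sublinear_def
proof (intro conjI allI impI add)
  fix t :: real and x assume "t \<ge> 0"
  show "p (t *\<^sub>R x) = t * p x"
  proof (cases "t = 0")
    case False
    with \<open>t \<ge> 0\<close> have "t > 0" by simp
    have "p x = p (inverse t *\<^sub>R (t *\<^sub>R x))" using False by simp
    also have "\<dots> \<le> inverse t * p (t *\<^sub>R x)" using \<open>t > 0\<close> by (intro scale) simp
    finally have "t * p x \<le> p (t *\<^sub>R x)" using \<open>t > 0\<close> by (simp add: field_simps)
    with scale[OF \<open>t > 0\<close>] show ?thesis by (simp add: antisym)
  qed (simp add: zero)
qed

lemma sublinear_zero: "sublinear p \<Longrightarrow> p 0 = 0"
  by (metis mult_zero_left order_refl scale_zero_left sublinear_def)

lemma sublinear_ge_minus: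
  assumes "sublinear p"
  shows "- p (- x) \<le> p x"
proof -
  have "p (x + - x) \<le> p x + p (- x)" using assms unfolding sublinear_def by blast
  then show ?thesis using sublinear_zero[OF assms] by simp
qed

text \<open>
This function lies below \<open>p\<close> and takes at \<open>- x\<close> a value of at most \<open>- p x\<close>, so a sublinear \<open>p\<close> that
is minimal must be additive in the direction \<open>x\<close>.
\<close>

definition slope_inf :: "('a::real_vector \<Rightarrow> real) \<Rightarrow> 'a \<Rightarrow> 'a \<Rightarrow> real" where
  "slope_inf p x y = (INF t\<in>{0..}. p (y + t *\<^sub>R x) - t * p x)"

lemma slope_inf_bdd:
  assumes "sublinear p"
  shows "bdd_below ((\<lambda>t. p (y + t *\<^sub>R x) - t * p x) ` {0..})"
proof (rule bdd_belowI2)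
  fix t :: real assume "t \<in> {0..}"
  then have "t * p x = p (t *\<^sub>R x)" using assms by (simp add: sublinear_def)
  also have "\<dots> = p ((y + t *\<^sub>R x) + - y)" by simp
  also have "\<dots> \<le> p (y + t *\<^sub>R x) + p (- y)" using assms unfolding sublinear_def by blast
  finally show "- p (- y) \<le> p (y + t *\<^sub>R x) - t * p x" by simp
qed

lemma slope_inf_le:
  assumes "sublinear p" "t \<ge> 0"
  shows "slope_inf p x y \<le> p (y + t *\<^sub>R x) - t * p x"
  unfolding slope_inf_def by (rule cINF_lower[OF slope_inf_bdd[OF assms(1)]]) (use assms in simp)

lemma slope_inf_greatest:
  assumes "\<And>t. t \<ge> 0 \<Longrightarrow> c \<le> p (y + t *\<^sub>R x) - t * p x"
  shows "c \<le> slope_inf p x y"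
  unfolding slope_inf_def by (rule cINF_greatest) (use assms in auto)

lemma sublinear_slope_inf:
  assumes p: "sublinear p"
  shows "sublinear (slope_inf p x)"
proof (rule sublinearI)
  fix y z
  have "slope_inf p x (y + z) - (p (z + u *\<^sub>R x) - u * p x) \<le> slope_inf p x y" if "u \<ge> 0" for u
  proof (rule slope_inf_greatest)
    fix t :: real assume "t \<ge> 0"
    have "slope_inf p x (y + z) \<le> p ((y + z) + (t + u) *\<^sub>R x) - (t + u) * p x"
      using \<open>t \<ge> 0\<close> \<open>u \<ge> 0\<close> by (intro slope_inf_le p) simp
    moreover have "(y + z) + (t + u) *\<^sub>R x = (y + t *\<^sub>R x) + (z + u *\<^sub>R x)"
      by (simp add: algebra_simps)
    moreover have "p ((y + t *\<^sub>R x) + (z + u *\<^sub>R x)) \<le> p (y + t *\<^sub>R x) + p (z + u *\<^sub>R x)"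
      using p unfolding sublinear_def by blast
    ultimately show "slope_inf p x (y + z) - (p (z + u *\<^sub>R x) - u * p x) \<le> p (y + t *\<^sub>R x) - t * p x"
      by (simp add: algebra_simps)
  qed
  then have "slope_inf p x (y + z) - slope_inf p x y \<le> slope_inf p x z"
    by (intro slope_inf_greatest) (simp add: algebra_simps)
  then show "slope_inf p x (y + z) \<le> slope_inf p x y + slope_inf p x z" by simp
next
  fix s :: real and y assume "s > 0"
  have "slope_inf p x (s *\<^sub>R y) / s \<le> slope_inf p x y"
  proof (rule slope_inf_greatest)
    fix t :: real assume "t \<ge> 0"
    have "slope_inf p x (s *\<^sub>R y) \<le> p (s *\<^sub>R y + (s * t) *\<^sub>R x) - (s * t) * p x"
      using \<open>t \<ge> 0\<close> \<open>s > 0\<close> by (intro slope_inf_le p) simp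
    also have "s *\<^sub>R y + (s * t) *\<^sub>R x = s *\<^sub>R (y + t *\<^sub>R x)"
      by (simp add: algebra_simps)
    also have "p \<dots> = s * p (y + t *\<^sub>R x)" using p \<open>s > 0\<close> by (simp add: sublinear_def)
    finally show "slope_inf p x (s *\<^sub>R y) / s \<le> p (y + t *\<^sub>R x) - t * p x"
      using \<open>s > 0\<close> by (simp add: field_simps)
  qed
  then show "slope_inf p x (s *\<^sub>R y) \<le> s * slope_inf p x y"
    using \<open>s > 0\<close> by (simp add: field_simps)
next
  show "slope_inf p x 0 = 0"
  proof (rule antisym)
    show "slope_inf p x 0 \<le> 0" using slope_inf_le[OF p, of 0 x 0] sublinear_zero[OF p] by simp
    show "0 \<le> slope_inf p x 0"
      using p by (intro slope_inf_greatest) (simp add: sublinear_def)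
  qed
qed

lemma linear_if_minimal_sublinear:
  fixes q :: "'a::real_vector \<Rightarrow> real"
  assumes q: "sublinear q" and min: "\<And>r. sublinear r \<Longrightarrow> r \<le> q \<Longrightarrow> r = q"
  shows "linear q"
proof -
  have "slope_inf q x = q" for x
  proof (rule min[OF sublinear_slope_inf[OF q]])
    show "slope_inf q x \<le> q"
      using slope_inf_le[OF q, of 0] by (auto simp: le_fun_def)
  qed
  then have "q y \<le> q (y + x) - q x" for x y
    using slope_inf_le[OF q, of 1 x y] by simp
  then have add: "q (x + y) = q x + q y" for x y
    using q unfolding sublinear_def by (smt (verit))
  have neg: "q (- x) = - q x" for x
    using add[of x "- x"] sublinear_zero[OF q] by simp
  have "q (t *\<^sub>R x) = t * q x" for t x
  proof (cases "t \<ge> 0")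
    case True
    then show ?thesis using q by (simp add: sublinear_def)
  next
    case False
    then have "q ((- t) *\<^sub>R x) = (- t) * q x"
      using q unfolding sublinear_def by (metis linear neg_0_le_iff_le)
    then show ?thesis by (simp add: neg)
  qed
  with add show ?thesis by (intro linearI) auto
qed

text \<open>
Zorn's lemma applies because the pointwise infimum of a chain of sublinear functions below \<open>p\<close> is
finite, being bounded from below by \<open>- p (- y)\<close>, and sublinear: for subadditivity, two members of the
chain can be replaced by the smaller one.
\<close>

lemma minimal_sublinear_below:
  fixes p :: "'a::real_vector \<Rightarrow> real"
  assumes p: "sublinear p"
  obtains q where "sublinear q" "q \<le> p" "\<And>r. sublinear r \<Longrightarrow> r \<le> q \<Longrightarrow> r = q"
proof -
  define A where "A = {q. sublinear q \<and> q \<le> p}"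
  let ?R = "relation_of (\<lambda>f g. g \<le> f) A"
  have "\<exists>m\<in>A. \<forall>a\<in>A. a \<le> m \<longrightarrow> a = m"
  proof (rule predicate_Zorn)
    show "partial_order_on A ?R"
      by (rule partial_order_on_relation_ofI) auto
    fix C assume C: "C \<in> Chains ?R"
    have CA: "q \<in> A" if "q \<in> C" for q
      using C that by (auto simp: Chains_def relation_of_def)
    have chain: "f \<le> g \<or> g \<le> f" if "f \<in> C" "g \<in> C" for f g
      using C that by (auto simp: Chains_def relation_of_def)
    show "\<exists>u\<in>A. \<forall>a\<in>C. u \<le> a"
    proof (cases "C = {}")
      case True
      then show ?thesis using p by (auto simp: A_def)
    next
      case False
      define u where "u y = (INF q\<in>C. q y)" for y
      have bdd: "bdd_below ((\<lambda>q. q y) ` C)" for y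
      proof (rule bdd_belowI2)
        fix q assume "q \<in> C"
        with CA have "sublinear q" "q (- y) \<le> p (- y)" by (auto simp: A_def le_fun_def)
        then show "- p (- y) \<le> q y" using sublinear_ge_minus[of q y] by simp
      qed
      have le: "u y \<le> q y" if "q \<in> C" for q y
        unfolding u_def by (rule cINF_lower[OF bdd that])
      have ge: "c \<le> u y" if "\<And>q. q \<in> C \<Longrightarrow> c \<le> q y" for c y
        unfolding u_def by (rule cINF_greatest[OF False that])
      have sub: "sublinear q" if "q \<in> C" for q using CA[OF that] by (simp add: A_def)
      have "sublinear u"
      proof (rule sublinearI)
        fix x y
        have "u (x + y) \<le> q1 x + q2 y" if q12: "q1 \<in> C" "q2 \<in> C" for q1 q2
        proof -
          obtain q where q: "q \<in> C" "q \<le> q1" "q \<le> q2"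
            using chain[OF q12] q12 by blast
          have "u (x + y) \<le> q (x + y)" by (rule le[OF q(1)])
          also have "\<dots> \<le> q x + q y" using sub[OF q(1)] by (simp add: sublinear_def)
          also have "\<dots> \<le> q1 x + q2 y" using q by (intro add_mono) (auto simp: le_fun_def)
          finally show ?thesis .
        qed
        then have "u (x + y) - q2 y \<le> u x" if "q2 \<in> C" for q2
          using that by (intro ge) (simp add: algebra_simps)
        then have "u (x + y) - u x \<le> u y"
          by (intro ge) (simp add: algebra_simps)
        then show "u (x + y) \<le> u x + u y" by simp
      next
        fix t :: real and x assume "t > 0"
        have "u (t *\<^sub>R x) / t \<le> u x"
        proof (rule ge)
          fix q assume "q \<in> C"
          with le[of q "t *\<^sub>R x"] sub[of q] \<open>t > 0\<close> have "u (t *\<^sub>R x) \<le> t * q x"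
            by (simp add: sublinear_def)
          then show "u (t *\<^sub>R x) / t \<le> q x" using \<open>t > 0\<close> by (simp add: field_simps)
        qed
        then show "u (t *\<^sub>R x) \<le> t * u x" using \<open>t > 0\<close> by (simp add: field_simps)
      next
        have "(\<lambda>q. q 0) ` C = {0}" using False sublinear_zero[OF sub] by force
        then show "u 0 = 0" by (simp add: u_def)
      qed
      moreover have "u \<le> p"
      proof -
        obtain q where "q \<in> C" using False by blast
        then show ?thesis using le[of q] CA[of q] by (force simp: A_def le_fun_def intro: order_trans)
      qed
      ultimately show ?thesis using le by (intro bexI[of _ u]) (auto simp: A_def le_fun_def)
    qed
  qed
  then obtain m where "m \<in> A" "\<forall>a\<in>A. a \<le> m \<longrightarrow> a = m" by blast
  then show thesis by (intro that[of m]) (auto simp: A_def)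
qed

text \<open>
Starting the minimization at \<open>slope_inf p x\<close> instead of \<open>p\<close> forces the linear functional to be at
most \<open>- p x\<close> at \<open>- x\<close>, hence to touch \<open>p\<close> at \<open>x\<close>.
\<close>

lemma Hahn_Banach_supporting_functional:
  fixes p :: "'a::real_vector \<Rightarrow> real"
  assumes p: "sublinear p"
  obtains q where "linear q" "\<And>y. q y \<le> p y" "q x = p x"
proof -
  obtain q where q: "sublinear q" "q \<le> slope_inf p x" "\<And>r. sublinear r \<Longrightarrow> r \<le> q \<Longrightarrow> r = q"
    using minimal_sublinear_below[OF sublinear_slope_inf[OF p, of x]] by blast
  have lin: "linear q" by (rule linear_if_minimal_sublinear[OF q(1,3)])
  have le: "q y \<le> p y" for y
    using slope_inf_le[OF p, of 0 x y] q(2) by (auto simp: le_fun_def intro: order_trans)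
  have "q (- x) \<le> - p x"
    using slope_inf_le[OF p, of 1 x "- x"] q(2) sublinear_zero[OF p]
    by (auto simp: le_fun_def intro: order_trans)
  then have "q x = p x" using le[of x] linear_neg[OF lin, of x] by simp
  with lin le that show thesis by blast
qed

context banach_over
begin

lemma dual_functional_exists:
  assumes add: "\<And>x y. f (x + y) = f x + f y" and sc: "\<And>c x. f (smul c x) = c * f x"
    and bd: "\<And>x. norm (f x) \<le> C * norm x"
  obtains \<xi> where "\<xi> \<in> dual smul" "blinfun_apply \<xi> = f"
proof -
  have "f (r *\<^sub>R x) = r *\<^sub>R f x" for r x
    unfolding scaleR_conv_of_real using sc[of "of_real r" x] by (simp only: scale_of_real)
  then have "bounded_linear f"
    using add bd by (intro bounded_linear_intro[where K=C]) (auto simp: mult.commute)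
  then have "blinfun_apply (Blinfun f) = f" by (rule bounded_linear_Blinfun_apply)
  then show thesis using sc by (intro that[of "Blinfun f"]) (auto simp: dual_def)
qed

text \<open>
For complex scalars, a real functional \<open>q\<close> is the real part of the linear functional
\<open>u \<mapsto> q u - i q (i u)\<close>. In both cases a linear functional whose real part is dominated by the norm is
itself dominated by the norm: multiplying \<open>u\<close> by a scalar of modulus one makes its value real.
\<close>

lemma supporting_functional:
  obtains \<xi> where "\<xi> \<in> dual smul" "norm \<xi> \<le> 1" "norm (blinfun_apply \<xi> x) \<ge> norm x"
proof -
  obtain \<phi> :: "'f \<Rightarrow> complex" where \<phi>: "\<And>x y. \<phi> (x + y) = \<phi> x + \<phi> y" "\<And>x y. \<phi> (x * y) = \<phi> x * \<phi> y"
    "\<And>x. norm (\<phi> x) = norm x" "\<And>r. \<phi> (of_real r) = of_real r"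
    "range \<phi> = \<real> \<or> range \<phi> = UNIV" "inj \<phi>"
    using scalar_embedding by metis
  have "sublinear (norm :: 'a \<Rightarrow> real)"
    by (simp add: sublinear_def norm_triangle_ineq)
  then obtain q :: "'a \<Rightarrow> real" where q: "linear q" "\<And>y. q y \<le> norm y" "q x = norm x"
    using Hahn_Banach_supporting_functional by metis
  have q_add: "q (u + v) = q u + q v" for u v using linear_add[OF q(1)] .
  have q_real: "q (smul (of_real r) u) = r * q u" for r u
    using linear_cmul[OF q(1), of r u] by (simp add: scale_of_real)
  obtain f where f: "\<And>u v. f (u + v) = f u + f v" "\<And>c u. f (smul c u) = c * f u" "\<And>u. Re (\<phi> (f u)) = q u"
    using \<phi>(5)
  proof
    assume range: "range \<phi> = \<real>"
    have of_real: "\<exists>r. c = of_real r" for c :: 'f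
    proof -
      have "\<phi> c \<in> \<real>" using range by blast
      then obtain r where "\<phi> c = of_real r" by (auto elim: Reals_cases)
      then have "\<phi> c = \<phi> (of_real r)" by (simp add: \<phi>(4))
      then show ?thesis using \<phi>(6) by (auto dest: injD)
    qed
    show thesis
    proof (rule that[of "\<lambda>u. of_real (q u)"])
      fix c :: 'f and u
      obtain r where "c = of_real r" using of_real by blast
      then show "of_real (q (smul c u)) = c * of_real (q u)" by (simp add: q_real)
    qed (simp_all add: q_add \<phi>)
  next
    assume "range \<phi> = UNIV"
    then obtain i where i: "\<phi> i = \<i>" by (metis surjD)
    have "\<phi> (i * i) = \<phi> (of_real (-1))" unfolding \<phi>(2) \<phi>(4) i by simp
    then have ii: "i * i = -1" using \<phi>(6) by (auto dest: injD)
    have decomp: "\<exists>a b. c = of_real a + of_real b * i" for c :: 'f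
    proof -
      have "\<phi> c = \<phi> (of_real (Re (\<phi> c)) + of_real (Im (\<phi> c)) * i)"
        by (simp add: \<phi> i complex_eq_iff)
      then show ?thesis using \<phi>(6) by (auto dest: injD)
    qed
    show thesis
    proof (rule that[of "\<lambda>u. of_real (q u) + of_real (- q (smul i u)) * i"])
      fix u v
      show "of_real (q (u + v)) + of_real (- q (smul i (u + v))) * i =
        of_real (q u) + of_real (- q (smul i u)) * i + (of_real (q v) + of_real (- q (smul i v)) * i)"
        by (simp add: q_add scale_right_distrib algebra_simps)
      show "Re (\<phi> (of_real (q u) + of_real (- q (smul i u)) * i)) = q u"
        by (simp only: \<phi> i) simp
    next
      fix c u
      obtain a b where c: "c = of_real a + of_real b * i" using decomp by blast
      have 1: "q (smul c u) = a * q u + b * q (smul i u)"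
        by (simp add: c scale_left_distrib q_add q_real flip: scale_scale)
      have "i * c = of_real a * i + of_real b * (i * i)"
        by (simp add: c algebra_simps)
      then have i_c: "i * c = of_real a * i + of_real (- b)"
        by (simp add: ii)
      have "smul i (smul c u) = smul (of_real a) (smul i u) + smul (of_real (- b)) u"
        using i_c by (simp add: scale_left_diff_distrib)
      then have 2: "q (smul i (smul c u)) = a * q (smul i u) - b * q u"
        by (simp only: q_add q_real)
      have "c * (of_real (q u) + of_real (- q (smul i u)) * i) =
        of_real (a * q u) + of_real (b * q u - a * q (smul i u)) * i - of_real (b * q (smul i u)) * (i * i)"
        by (simp add: c algebra_simps)
      then show "of_real (q (smul c u)) + of_real (- q (smul i (smul c u))) * i =
          c * (of_real (q u) + of_real (- q (smul i u)) * i)"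
        unfolding ii 1 2 by simp
    qed
  qed
  have f_le: "norm (f u) \<le> 1 * norm u" for u
  proof (cases "f u = 0")
    case False
    define s where "s = of_real (norm (f u)) / f u"
    have "norm s = 1" using False by (simp add: s_def norm_divide)
    have "f (smul s u) = of_real (norm (f u))" using False by (simp add: f(2) s_def)
    then have "norm (f u) = q (smul s u)" using f(3)[of "smul s u"] by (simp add: \<phi>(4))
    also have "\<dots> \<le> norm (smul s u)" by (rule q(2))
    finally show ?thesis by (simp add: norm_scale \<open>norm s = 1\<close>)
  qed simp
  obtain \<xi> where \<xi>: "\<xi> \<in> dual smul" "blinfun_apply \<xi> = f"
    using dual_functional_exists[OF f(1,2) f_le] .
  moreover have "norm \<xi> \<le> 1" by (rule norm_blinfun_bound) (use f_le \<xi>(2) in auto)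
  moreover have "norm (f x) \<ge> norm x"
    using f(3)[of x] q(3) \<phi>(3)[of "f x"] complex_Re_le_cmod[of "\<phi> (f x)"] by simp
  ultimately show thesis by (intro that[of \<xi>]) auto
qed

end

text \<open>
This is condition (iv); conditions (i), (v) and (vi) reduce to it by a suitable choice of \<open>S\<close>.
\<close>

lemma gelfand_phillips_if_ssp_at_norming:
  fixes smul :: "'f::real_or_complex \<Rightarrow> 'a::banach \<Rightarrow> 'a"
  assumes "norming smul S" "selectively_seq_pseudocompact_at (weak_star smul) S"
  shows "gelfand_phillips smul"
  unfolding gelfand_phillips_def
proof (intro allI impI)
  fix B assume B: "limited smul B"
  have S: "S \<subseteq> dual smul" "bounded S" using assms(1) by (auto simp: norming_def)
  obtain C where C: "C > 0" "\<And>x. norm x \<le> C * sup_norm_on S (\<lambda>\<xi>. blinfun_apply \<xi> x)"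
    using assms(1) by (auto simp: norming_def)
  show "compact (closure B)"
  proof (rule compact_closure_if_uniformly_convergent_subsequences[OF C])
    show "bounded B" using B by (simp add: limited_def)
  qed (rule ssp_imp_uniformly_convergent_subsequence[OF assms(2) S B])
qed

section \<open>Choices of the norming set\<close>

lemma ssp_at_subtopology:
  assumes ssp: "selectively_seq_pseudocompact_at (subtopology Y T) A" and "A \<subseteq> T"
  shows "selectively_seq_pseudocompact_at Y A"
  unfolding selectively_seq_pseudocompact_at_def
proof (intro allI impI)
  fix U :: "nat \<Rightarrow> 'a set" assume U: "\<forall>n. openin Y (U n) \<and> U n \<inter> A \<noteq> {}"
  define V where "V n = U n \<inter> T" for n
  have "openin (subtopology Y T) (V n) \<and> V n \<inter> A \<noteq> {}" for n
    using U \<open>A \<subseteq> T\<close> by (fastforce simp: V_def intro: openin_subtopology_Int)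
  then obtain x r l where "\<And>n. x n \<in> V n" "strict_mono (r :: nat \<Rightarrow> nat)"
    "limitin (subtopology Y T) (x \<circ> r) l sequentially"
    using ssp unfolding selectively_seq_pseudocompact_at_def by metis
  then show "\<exists>x. (\<forall>n. x n \<in> U n) \<and> (\<exists>r l. strict_mono (r :: nat \<Rightarrow> nat) \<and> limitin Y (x \<circ> r) l sequentially)"
    by (auto simp: V_def limitin_subtopology)
qed

lemma ssp_at_continuous_image:
  assumes ssp: "selectively_seq_pseudocompact_at X A" and f: "continuous_map X Y f" and A: "A \<subseteq> topspace X"
  shows "selectively_seq_pseudocompact_at Y (f ` A)"
  unfolding selectively_seq_pseudocompact_at_def
proof (intro allI impI)
  fix U :: "nat \<Rightarrow> 'b set" assume U: "\<forall>n. openin Y (U n) \<and> U n \<inter> f ` A \<noteq> {}"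
  define V where "V n = {x \<in> topspace X. f x \<in> U n}" for n
  have "openin X (V n) \<and> V n \<inter> A \<noteq> {}" for n
    using U A openin_continuous_map_preimage[OF f] by (fastforce simp: V_def)
  then obtain x r l where x: "\<And>n. x n \<in> V n" "strict_mono (r :: nat \<Rightarrow> nat)" "limitin X (x \<circ> r) l sequentially"
    using ssp unfolding selectively_seq_pseudocompact_at_def by metis
  have "limitin Y (f \<circ> x \<circ> r) (f l) sequentially"
    using continuous_map_limit[OF f x(3)] by (simp add: comp_assoc)
  with x show "\<exists>x. (\<forall>n. x n \<in> U n) \<and> (\<exists>r l. strict_mono (r :: nat \<Rightarrow> nat) \<and> limitin Y (x \<circ> r) l sequentially)"
    by (intro exI[of _ "f \<circ> x"]) (auto simp: V_def)
qed

lemma norm_blinfun_apply_le: "norm \<xi> \<le> 1 \<Longrightarrow> norm (blinfun_apply \<xi> x) \<le> norm x"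
  using norm_blinfun[of \<xi> x] mult_right_mono[of "norm \<xi>" 1 "norm x"] by simp

lemma sup_norm_on_unit_functionals_le:
  assumes "S \<subseteq> cball 0 1"
  shows "sup_norm_on S (\<lambda>\<xi>. blinfun_apply \<xi> x) \<le> norm x"
proof (rule sup_norm_on_le)
  fix \<xi> assume "\<xi> \<in> S"
  then have "norm \<xi> \<le> 1" using assms by auto
  then show "norm (blinfun_apply \<xi> x) \<le> norm x"
    by (rule norm_blinfun_apply_le)
qed simp

lemma normingI_unit_functionals:
  assumes "S \<subseteq> dual smul" "S \<subseteq> cball 0 1" "\<And>x. norm x \<le> sup_norm_on S (\<lambda>\<xi>. blinfun_apply \<xi> x)"
  shows "norming smul S"
  unfolding norming_def
  using assms sup_norm_on_unit_functionals_le[OF assms(2)] bounded_subset[OF bounded_cball assms(2)]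
  by (intro conjI exI[of _ 1]) auto

context banach_over
begin

lemma norming_dual_unit_ball: "norming smul (dual smul \<inter> cball 0 1)"
proof (rule normingI_unit_functionals)
  fix x
  let ?S = "dual smul \<inter> cball 0 1"
  obtain \<xi> where \<xi>: "\<xi> \<in> dual smul" "norm \<xi> \<le> 1" "norm (blinfun_apply \<xi> x) \<ge> norm x"
    by (rule supporting_functional)
  have "bounded ?S" by (rule bounded_subset[OF bounded_cball]) auto
  then have "norm (blinfun_apply \<xi> x) \<le> sup_norm_on ?S (\<lambda>\<xi>. blinfun_apply \<xi> x)"
    by (rule norm_le_sup_norm_on[OF bounded_evaluation_image]) (use \<xi> in simp)
  with \<xi>(3) show "norm x \<le> sup_norm_on ?S (\<lambda>\<xi>. blinfun_apply \<xi> x)" by simp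
qed auto

lemma gelfand_phillips_if_dual_ball_ssp:
  assumes "selectively_seq_pseudocompact (subtopology (weak_star smul) (cball 0 1))"
  shows "gelfand_phillips smul"
proof (rule gelfand_phillips_if_ssp_at_norming[OF norming_dual_unit_ball])
  show "selectively_seq_pseudocompact_at (weak_star smul) (dual smul \<inter> cball 0 1)"
    using assms unfolding selectively_seq_pseudocompact_def topspace_subtopology topspace_weak_star
    by (rule ssp_at_subtopology[OF _ Int_lower2])
qed

section \<open>Separable subspaces and extension of weak* null sequences\<close>

text \<open>
The sequential Banach--Alaoglu theorem for a separable subspace: functionals of norm at most one are
equicontinuous, so convergence on a dense subset extends to the whole subspace.
\<close>

lemma pointwise_convergent_subsequence:
  assumes X: "separable_space (top_of_set X)" and \<eta>: "\<And>n. norm (\<eta> n :: 'a \<Rightarrow>\<^sub>L 'f) \<le> 1"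
  shows "\<exists>r. strict_mono (r :: nat \<Rightarrow> nat) \<and> (\<forall>x\<in>X. convergent (\<lambda>n. blinfun_apply (\<eta> (r n)) x))"
proof -
  obtain D where D: "countable D" "D \<subseteq> X" "X \<subseteq> closure D"
    using X unfolding separable_space_def by (auto simp: closure_of_subtopology Int_absorb1)
  have le: "norm (blinfun_apply (\<eta> n) x) \<le> norm x" for n x
    by (rule norm_blinfun_apply_le[OF \<eta>])
  have "bounded (range (\<lambda>n. blinfun_apply (\<eta> n) x))" for x
    using le by (auto simp: bounded_iff)
  then obtain r :: "nat \<Rightarrow> nat" where r: "strict_mono r" "\<And>x. x \<in> D \<Longrightarrow> convergent (\<lambda>n. blinfun_apply (\<eta> (r n)) x)"
    using diagonal_convergent_subsequence[OF D(1), of "\<lambda>n. blinfun_apply (\<eta> n)"] by blast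
  have "Cauchy (\<lambda>n. blinfun_apply (\<eta> (r n)) x)" if "x \<in> X" for x
    unfolding Cauchy_def
  proof (intro allI impI)
    fix e :: real assume "e > 0"
    then have "e / 3 > 0" by simp
    moreover have "x \<in> closure D" using D(3) that by blast
    ultimately obtain y where y: "y \<in> D" "dist y x < e / 3"
      unfolding closure_approachable by blast
    have near: "dist (blinfun_apply (\<eta> (r n)) x) (blinfun_apply (\<eta> (r n)) y) < e / 3" for n
      using le[of "r n" "x - y"] y(2) by (simp add: dist_norm blinfun.diff_right norm_minus_commute)
    obtain N where N: "\<forall>m\<ge>N. \<forall>n\<ge>N. dist (blinfun_apply (\<eta> (r m)) y) (blinfun_apply (\<eta> (r n)) y) < e / 3"
      using convergent_Cauchy[OF r(2)[OF y(1)]] \<open>e / 3 > 0\<close> unfolding Cauchy_def by blast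
    have "dist (blinfun_apply (\<eta> (r m)) x) (blinfun_apply (\<eta> (r n)) x) < e" if "m \<ge> N" "n \<ge> N" for m n
    proof -
      have "dist (blinfun_apply (\<eta> (r m)) x) (blinfun_apply (\<eta> (r n)) x) \<le>
          dist (blinfun_apply (\<eta> (r m)) x) (blinfun_apply (\<eta> (r m)) y) +
          (dist (blinfun_apply (\<eta> (r m)) y) (blinfun_apply (\<eta> (r n)) y) +
           dist (blinfun_apply (\<eta> (r n)) x) (blinfun_apply (\<eta> (r n)) y))"
        using dist_triangle[of "blinfun_apply (\<eta> (r m)) x" "blinfun_apply (\<eta> (r n)) x" "blinfun_apply (\<eta> (r m)) y"]
          dist_triangle2[of "blinfun_apply (\<eta> (r m)) y" "blinfun_apply (\<eta> (r n)) x" "blinfun_apply (\<eta> (r n)) y"]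
        by linarith
      also have "\<dots> < e / 3 + (e / 3 + e / 3)"
        using N that by (intro add_strict_mono near) auto
      finally show ?thesis by simp
    qed
    then show "\<exists>N. \<forall>m\<ge>N. \<forall>n\<ge>N. dist (blinfun_apply (\<eta> (r m)) x) (blinfun_apply (\<eta> (r n)) x) < e" by blast
  qed
  with r(1) show ?thesis by (auto simp: Cauchy_convergent_iff)
qed

lemma continuous_on_smul: "continuous_on UNIV (\<lambda>x. smul c x)"
proof -
  have "bounded_linear (\<lambda>x. smul c x)"
  proof (rule bounded_linear_intro[where K = "norm c"])
    fix r and x :: 'a
    show "smul c (r *\<^sub>R x) = r *\<^sub>R smul c x"
      unfolding scale_of_real[symmetric] scale_scale by (simp only: mult.commute)
  qed (simp_all add: scale_right_distrib norm_scale mult.commute)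
  then show ?thesis by (rule linear_continuous_on)
qed

text \<open>
Linear combinations of the \<open>b n\<close> with coefficients in a countable dense set of scalars form a countable
set \<open>D\<close>, and its closure is a subspace. Multiplication by an arbitrary scalar leads from \<open>D\<close> into the
closure, because the coefficients are dense.
\<close>

lemma separable_closed_subspace_containing:
  fixes b :: "nat \<Rightarrow> 'a"
  obtains X where "separable_banach_subspace smul X" "range b \<subseteq> X"
proof -
  obtain Q :: "'f set" where Q: "countable Q" "closure Q = UNIV"
    using countable_dense_scalars by metis
  define comb where "comb xs = sum_list (map (\<lambda>(c, n). smul c (b n)) xs)" for xs :: "('f \<times> nat) list"
  define D where "D = comb ` lists (Q \<times> UNIV)"
  have "countable D" unfolding D_def using Q(1) by (intro countable_image countable_lists) auto
  have comb_append: "comb (xs @ ys) = comb xs + comb ys" for xs ys by (simp add: comb_def)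
  have D_add: "x + y \<in> D" if "x \<in> D" "y \<in> D" for x y
    using that unfolding D_def by (force simp flip: comb_append)
  have cl_add: "x + y \<in> closure D" if xy: "x \<in> closure D" "y \<in> closure D" for x y
  proof -
    obtain u v where "\<And>n. u n \<in> D" "u \<longlonglongrightarrow> x" "\<And>n. v n \<in> D" "v \<longlonglongrightarrow> y"
      using xy unfolding closure_sequential by blast
    then show ?thesis unfolding closure_sequential
      by (intro exI[of _ "\<lambda>n. u n + v n"]) (auto intro: D_add tendsto_add)
  qed
  have cl_smul_b: "smul c (b n) \<in> closure D" for c n
  proof -
    have "c \<in> closure Q" using Q(2) by simp
    then obtain q where q: "\<And>k. q k \<in> Q" "q \<longlonglongrightarrow> c" unfolding closure_sequential by blast
    have "(\<lambda>k. smul (q k) (b n)) \<longlonglongrightarrow> smul c (b n)"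
    proof (rule iffD1[OF tendsto_dist_iff[THEN sym]])
      have "(\<lambda>k. dist (q k) c * norm (b n)) \<longlonglongrightarrow> 0 * norm (b n)"
        using q(2) by (intro tendsto_mult tendsto_const) (simp flip: tendsto_dist_iff)
      then show "(\<lambda>k. dist (smul (q k) (b n)) (smul c (b n))) \<longlonglongrightarrow> 0"
        by (simp add: dist_norm norm_scale flip: scale_left_diff_distrib)
    qed
    moreover have "smul (q k) (b n) \<in> D" for k
      unfolding D_def by (rule image_eqI[of _ _ "[(q k, n)]"]) (use q(1) in \<open>auto simp: comb_def\<close>)
    ultimately show ?thesis unfolding closure_sequential
      by (intro exI[of _ "\<lambda>k. smul (q k) (b n)"]) simp
  qed
  have zero: "0 \<in> closure D"
    by (rule subsetD[OF closure_subset]) (auto simp: D_def comb_def intro!: image_eqI[of _ _ "[]"])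
  have smul_D: "smul c (comb xs) \<in> closure D" for c xs
  proof (induction xs)
    case Nil
    then show ?case using zero by (simp add: comb_def)
  next
    case (Cons p xs)
    then show ?case
      by (cases p) (auto simp: comb_def scale_right_distrib intro!: cl_add cl_smul_b)
  qed
  have cl_smul: "smul c x \<in> closure D" if "x \<in> closure D" for c x
  proof -
    have "smul c ` D \<subseteq> closure D" using smul_D by (auto simp: D_def)
    then have "smul c ` closure D \<subseteq> closure D"
      by (intro image_closure_subset continuous_on_subset[OF continuous_on_smul]) auto
    with that show ?thesis by blast
  qed
  have "separable_banach_subspace smul (closure D)"
    unfolding separable_banach_subspace_def
  proof (intro conjI)
    show "subspace (closure D)" by (intro subspaceI zero cl_add cl_smul)
    show "separable_space (top_of_set (closure D))"
      unfolding separable_space_def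
      by (rule exI[of _ D]) (simp add: \<open>countable D\<close> closure_subset closure_of_subtopology Int_absorb1)
  qed simp
  moreover have "range b \<subseteq> closure D" using cl_smul_b[of 1] by auto
  ultimately show thesis by (rule that)
qed

text \<open>
Given functionals in the dual unit ball, a subsequence converges pointwise on a separable subspace
\<open>X\<close> containing \<open>b\<close>. The limit lives on \<open>X\<close> only, so the differences to it form a weak* null
sequence in the dual of \<open>X\<close>. Once a subsequence of the differences extends to a weak* null sequence
on the whole space, limitedness makes the convergence uniform on \<open>b\<close>. The subspace may depend on
\<open>b\<close>; for a separable space, the whole space serves and there is nothing to extend.
\<close>

lemma gelfand_phillips_if_weak_star_null_extensions:
  assumes ext: "\<And>b :: nat \<Rightarrow> 'a. \<exists>X. separable_banach_subspace smul X \<and> range b \<subseteq> X \<and>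
    (\<forall>\<xi>. (\<forall>n. operator_on smul (*) X (\<xi> n)) \<and> (\<forall>x\<in>X. (\<lambda>n. \<xi> n x) \<longlonglongrightarrow> 0) \<longrightarrow>
        (\<exists>r \<psi>. strict_mono (r :: nat \<Rightarrow> nat) \<and> weak_star_null smul \<psi> \<and>
           (\<forall>n. \<forall>x\<in>X. blinfun_apply (\<psi> n) x = \<xi> (r n) x)))"
  shows "gelfand_phillips smul"
  unfolding gelfand_phillips_def
proof (intro allI impI)
  fix B assume B: "limited smul B"
  let ?S = "dual smul \<inter> cball 0 1"
  obtain C where C: "C > 0" "\<And>x. norm x \<le> C * sup_norm_on ?S (\<lambda>\<xi>. blinfun_apply \<xi> x)"
    using norming_dual_unit_ball by (auto simp: norming_def)
  show "compact (closure B)"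
  proof (rule compact_closure_if_uniformly_convergent_subsequences[OF C])
    show "bounded B" using B by (simp add: limited_def)
    fix b :: "nat \<Rightarrow> 'a" and \<eta> :: "nat \<Rightarrow> 'a \<Rightarrow>\<^sub>L 'f"
    assume b: "range b \<subseteq> B" and \<eta>: "range \<eta> \<subseteq> ?S"
    obtain X where X: "separable_banach_subspace smul X" "range b \<subseteq> X" and
      extX: "\<And>\<xi>. (\<And>n. operator_on smul (*) X (\<xi> n)) \<Longrightarrow> (\<And>x. x \<in> X \<Longrightarrow> (\<lambda>n. \<xi> n x) \<longlonglongrightarrow> 0) \<Longrightarrow>
        (\<exists>r \<psi>. strict_mono (r :: nat \<Rightarrow> nat) \<and> weak_star_null smul \<psi> \<and>
           (\<forall>n. \<forall>x\<in>X. blinfun_apply (\<psi> n) x = \<xi> (r n) x))"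
      using ext[of b] by metis
    have \<eta>1: "norm (\<eta> n) \<le> 1" "\<eta> n \<in> dual smul" for n
      using subsetD[OF \<eta>, of "\<eta> n"] by auto
    have le: "norm (blinfun_apply (\<eta> n) x) \<le> norm x" for n x
      by (rule norm_blinfun_apply_le[OF \<eta>1(1)])
    have sub: "subspace X" using X(1) by (simp add: separable_banach_subspace_def)
    obtain s :: "nat \<Rightarrow> nat" where s: "strict_mono s" "\<And>x. x \<in> X \<Longrightarrow> convergent (\<lambda>n. blinfun_apply (\<eta> (s n)) x)"
      using pointwise_convergent_subsequence[of X \<eta>] X(1) \<eta>1(1) by (auto simp: separable_banach_subspace_def)
    define g where "g x = lim (\<lambda>n. blinfun_apply (\<eta> (s n)) x)" for x
    have g: "(\<lambda>n. blinfun_apply (\<eta> (s n)) x) \<longlonglongrightarrow> g x" if "x \<in> X" for x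
      using s(2)[OF that] by (simp add: g_def convergent_LIMSEQ_iff)
    have g_add: "g (x + y) = g x + g y" if "x \<in> X" "y \<in> X" for x y
      using tendsto_add[OF g[OF that(1)] g[OF that(2)]] g[OF subspace_add[OF sub that]]
      by (intro LIMSEQ_unique) (auto simp: blinfun.add_right)
    have g_smul: "g (smul c x) = c * g x" if "x \<in> X" for c x
      using tendsto_mult[OF tendsto_const g[OF that], of c] g[OF subspace_scale[OF sub that], of c] \<eta>1(2)
      by (intro LIMSEQ_unique) (auto simp: dual_def)
    have g_le: "norm (g x) \<le> norm x" if "x \<in> X" for x
      using g[OF that] le by (intro LIMSEQ_le_const2[OF tendsto_norm]) auto
    define \<xi> where "\<xi> n x = blinfun_apply (\<eta> (s n)) x - g x" for n x
    have "operator_on smul (*) X (\<xi> n)" for n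
      unfolding operator_on_def
    proof (intro conjI)
      show "\<exists>C. \<forall>x\<in>X. norm (\<xi> n x) \<le> C * norm x"
      proof (intro exI[of _ 2] ballI)
        fix x assume "x \<in> X"
        then show "norm (\<xi> n x) \<le> 2 * norm x"
          using norm_triangle_ineq4[of "blinfun_apply (\<eta> (s n)) x" "g x"] le[of "s n" x] g_le[of x]
          by (simp add: \<xi>_def)
      qed
    qed (use \<eta>1(2)[of "s n"] in \<open>auto simp: \<xi>_def g_add g_smul blinfun.add_right dual_def algebra_simps\<close>)
    moreover have "(\<lambda>n. \<xi> n x) \<longlonglongrightarrow> 0" if "x \<in> X" for x
      unfolding \<xi>_def using g[OF that] by (rule LIM_zero)
    ultimately obtain t \<psi> where t: "strict_mono (t :: nat \<Rightarrow> nat)" and \<psi>: "weak_star_null smul \<psi>"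
      and eq: "\<And>n x. x \<in> X \<Longrightarrow> blinfun_apply (\<psi> n) x = \<xi> (t n) x"
      using extX[of \<xi>] by metis
    have lim: "uniform_limit (range b) (\<lambda>n. blinfun_apply (\<psi> n)) (\<lambda>_. 0) sequentially"
      by (rule uniform_limit_on_subset[OF limited_uniform_limit_zero[OF B \<psi>] b])
    have "dist (blinfun_apply (\<eta> (s (t n))) x) (g x) = dist (blinfun_apply (\<psi> n) x) 0" if "x \<in> range b" for n x
      using eq[of x n] that X(2) by (auto simp: \<xi>_def dist_norm)
    with lim have "uniform_limit (range b) (\<lambda>n. blinfun_apply (\<eta> (s (t n)))) g sequentially"
      by (simp add: uniform_limit_iff)
    then show "\<exists>r. strict_mono (r :: nat \<Rightarrow> nat) \<and> uniformly_convergent_on (range b) (\<lambda>n. blinfun_apply (\<eta> (r n)))"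
      using strict_mono_o[OF s(1) t] by (intro exI[of _ "s \<circ> t"]) (auto simp: uniformly_convergent_on_def)
  qed
qed

lemma gelfand_phillips_if_separably_weak_star_extensible:
  assumes "separably_weak_star_extensible smul"
  shows "gelfand_phillips smul"
proof (rule gelfand_phillips_if_weak_star_null_extensions)
  fix b :: "nat \<Rightarrow> 'a"
  obtain X where "separable_banach_subspace smul X" "range b \<subseteq> X"
    by (rule separable_closed_subspace_containing)
  with assms show "\<exists>X. separable_banach_subspace smul X \<and> range b \<subseteq> X \<and>
    (\<forall>\<xi>. (\<forall>n. operator_on smul (*) X (\<xi> n)) \<and> (\<forall>x\<in>X. (\<lambda>n. \<xi> n x) \<longlonglongrightarrow> 0) \<longrightarrow>
        (\<exists>r \<psi>. strict_mono (r :: nat \<Rightarrow> nat) \<and> weak_star_null smul \<psi> \<and>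
           (\<forall>n. \<forall>x\<in>X. blinfun_apply (\<psi> n) x = \<xi> (r n) x)))"
    unfolding separably_weak_star_extensible_def by blast
qed

lemma operator_on_UNIV_imp_dual:
  assumes "operator_on smul (*) UNIV f"
  obtains \<xi> where "\<xi> \<in> dual smul" "blinfun_apply \<xi> = f"
  using assms dual_functional_exists[of f] unfolding operator_on_def by auto

lemma gelfand_phillips_if_separable:
  assumes "separable_space (euclidean :: 'a topology)"
  shows "gelfand_phillips smul"
proof (rule gelfand_phillips_if_weak_star_null_extensions)
  fix b :: "nat \<Rightarrow> 'a"
  show "\<exists>X. separable_banach_subspace smul X \<and> range b \<subseteq> X \<and>
    (\<forall>\<xi>. (\<forall>n. operator_on smul (*) X (\<xi> n)) \<and> (\<forall>x\<in>X. (\<lambda>n. \<xi> n x) \<longlonglongrightarrow> 0) \<longrightarrow>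
        (\<exists>r \<psi>. strict_mono (r :: nat \<Rightarrow> nat) \<and> weak_star_null smul \<psi> \<and>
           (\<forall>n. \<forall>x\<in>X. blinfun_apply (\<psi> n) x = \<xi> (r n) x)))"
  proof (intro exI[of _ UNIV] conjI allI impI)
    show "separable_banach_subspace smul UNIV"
      using assms by (simp add: separable_banach_subspace_def)
    fix \<xi> :: "nat \<Rightarrow> 'a \<Rightarrow> 'f"
    assume \<xi>: "(\<forall>n. operator_on smul (*) UNIV (\<xi> n)) \<and> (\<forall>x\<in>UNIV. (\<lambda>n. \<xi> n x) \<longlonglongrightarrow> 0)"
    then have "\<forall>n. \<exists>\<psi>. \<psi> \<in> dual smul \<and> blinfun_apply \<psi> = \<xi> n"
      using operator_on_UNIV_imp_dual by metis
    then obtain \<psi> where \<psi>: "\<And>n. \<psi> n \<in> dual smul" "\<And>n. blinfun_apply (\<psi> n) = \<xi> n" by metis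
    then have "weak_star_null smul \<psi>" using \<xi> by (auto simp: weak_star_null_iff)
    with \<psi>(2) show "\<exists>r \<psi>. strict_mono (r :: nat \<Rightarrow> nat) \<and> weak_star_null smul \<psi> \<and>
           (\<forall>n. \<forall>x\<in>UNIV. blinfun_apply (\<psi> n) x = \<xi> (r n) x)"
      by (intro exI[of _ id] exI[of _ \<psi>]) (auto simp: strict_mono_def)
  qed simp
qed

section \<open>From the separable \<open>c\<^sub>0\<close>-extension property to weak* extensibility\<close>

text \<open>
By Baire's theorem, some set on which all \<open>\<xi> n\<close> are bounded by \<open>k\<close> contains a relative ball of the
complete space \<open>X\<close>; by linearity the bound moves from its centre to the origin.
\<close>

lemma uniform_boundedness:
  fixes \<xi> :: "nat \<Rightarrow> 'a \<Rightarrow> 'f"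
  assumes X: "subspace X" "closed X" and op: "\<And>n. operator_on smul (*) X (\<xi> n)"
    and bdd: "\<And>x. x \<in> X \<Longrightarrow> bounded (range (\<lambda>n. \<xi> n x))"
  obtains C where "\<And>n x. x \<in> X \<Longrightarrow> norm (\<xi> n x) \<le> C * norm x"
proof -
  have add: "\<xi> n (x + y) = \<xi> n x + \<xi> n y" if "x \<in> X" "y \<in> X" for n x y
    using op that unfolding operator_on_def by blast
  have sc: "\<xi> n (smul c x) = c * \<xi> n x" if "x \<in> X" for n x c
    using op that unfolding operator_on_def by blast
  have diff: "\<xi> n (x - y) = \<xi> n x - \<xi> n y" if "x \<in> X" "y \<in> X" for n x y
    using add[of "x - y" y n] that subspace_diff[OF X(1) that] by (simp add: algebra_simps)
  have cont: "continuous_on X (\<xi> n)" for n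
  proof -
    obtain C where C: "\<And>y. y \<in> X \<Longrightarrow> norm (\<xi> n y) \<le> C * norm y"
      using op[of n] unfolding operator_on_def by blast
    have "dist (\<xi> n x) (\<xi> n y) \<le> max C 0 * dist x y" if "x \<in> X" "y \<in> X" for x y
    proof -
      have "norm (\<xi> n (x - y)) \<le> C * norm (x - y)" by (rule C[OF subspace_diff[OF X(1) that]])
      also have "\<dots> \<le> max C 0 * norm (x - y)" by (intro mult_right_mono) auto
      finally show ?thesis by (simp add: dist_norm diff that)
    qed
    then have "(max C 0)-lipschitz_on X (\<xi> n)" by (intro lipschitz_onI) auto
    then show ?thesis by (rule lipschitz_on_continuous_on)
  qed
  define G where "G k = {x \<in> X. \<forall>n. norm (\<xi> n x) \<le> real k}" for k
  have closedG: "closedin (top_of_set X) (G k)" for k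
  proof -
    have "G k = (\<Inter>n. X \<inter> \<xi> n -` cball 0 (real k))" by (auto simp: G_def)
    moreover have "closedin (top_of_set X) (\<Inter>n. X \<inter> \<xi> n -` cball 0 (real k))"
      by (intro closedin_INT continuous_closedin_preimage cont) auto
    ultimately show ?thesis by simp
  qed
  have "(\<Union>k. G k) = X"
  proof
    show "X \<subseteq> (\<Union>k. G k)"
    proof
      fix x assume "x \<in> X"
      then obtain a where "\<And>n. norm (\<xi> n x) \<le> a" using bdd[of x] by (auto simp: bounded_iff)
      moreover obtain k where "a \<le> real k" using real_arch_simple by blast
      ultimately show "x \<in> (\<Union>k. G k)" using \<open>x \<in> X\<close> by (auto simp: G_def intro: order_trans)
    qed
  qed (auto simp: G_def)
  moreover have "completely_metrizable_space (top_of_set X)"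
    using X(2) by (intro completely_metrizable_space_closedin completely_metrizable_space_euclidean) simp
  moreover have "0 \<in> X" by (rule subspace_0[OF X(1)])
  ultimately have "\<not> (\<forall>k. top_of_set X interior_of G k = {})"
    using Baire_category_alt[of "top_of_set X" "range G"] closedG
      interior_of_topspace[of "top_of_set X"] by auto
  then obtain k where "top_of_set X interior_of G k \<noteq> {}" by blast
  then obtain x0 W where W: "openin (top_of_set X) W" "x0 \<in> W" "W \<subseteq> G k"
    by (auto simp: interior_of_def)
  then obtain d where d: "d > 0" "ball x0 d \<inter> X \<subseteq> W" and "x0 \<in> X"
    by (meson openin_contains_ball openin_imp_subset subsetD)
  have ball: "norm (\<xi> n x) \<le> real k" if "x \<in> X" "dist x x0 < d" for n x
  proof -
    have "x \<in> ball x0 d \<inter> X" using that by (simp add: dist_commute)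
    with d(2) W(3) have "x \<in> G k" by blast
    then show ?thesis by (simp add: G_def)
  qed
  have "norm (\<xi> n x) \<le> (4 * real k / d) * norm x" if "x \<in> X" for n x
  proof (cases "x = 0")
    case True
    then show ?thesis using add[OF \<open>0 \<in> X\<close> \<open>0 \<in> X\<close>, of n] by simp
  next
    case False
    \<comment> \<open>Scaling by \<open>a\<close> brings \<open>x\<close> to length \<open>d / 2\<close>, inside the ball around \<open>x0\<close>.\<close>
    define a where "a = d / (2 * norm x)"
    have "a > 0" using False d by (simp add: a_def)
    have ax: "smul (of_real a) x \<in> X" by (rule subspace_scale[OF X(1) that])
    have "norm (smul (of_real a) x) < d"
      using False d \<open>a > 0\<close> by (simp add: norm_scale) (simp add: a_def)
    then have "norm (\<xi> n (x0 + smul (of_real a) x)) \<le> real k"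
      using subspace_add[OF X(1) \<open>x0 \<in> X\<close> ax] by (intro ball) (auto simp: dist_norm)
    moreover have "norm (\<xi> n x0) \<le> real k" using \<open>x0 \<in> X\<close> d by (intro ball) auto
    moreover have "of_real a * \<xi> n x = \<xi> n (x0 + smul (of_real a) x) - \<xi> n x0"
      using add[OF \<open>x0 \<in> X\<close> ax] sc[OF that] by simp
    ultimately have "norm (of_real a * \<xi> n x) \<le> real k + real k"
      using norm_triangle_ineq4[of "\<xi> n (x0 + smul (of_real a) x)" "\<xi> n x0"] by simp
    then have "a * norm (\<xi> n x) \<le> 2 * real k" using \<open>a > 0\<close> by (simp add: norm_mult)
    then show ?thesis using False d by (simp add: a_def field_simps)
  qed
  then show thesis by (rule that)
qed

text \<open>
A weak* null sequence on \<open>X\<close> is the sequence of coordinates of an operator \<open>T\<close> from \<open>X\<close> to \<open>c\<^sub>0\<close>, which is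
bounded by the uniform boundedness principle; the coordinates of an extension of \<open>T\<close> extend the
sequence itself.
\<close>

lemma separably_weak_star_extensible_if_c0_extension:
  assumes c0ext: "separable_c0_extension_property smul"
  shows "separably_weak_star_extensible smul"
  unfolding separably_weak_star_extensible_def
proof (intro allI impI, elim conjE)
  fix X and \<xi> :: "nat \<Rightarrow> 'a \<Rightarrow> 'f"
  assume X: "separable_banach_subspace smul X" and op: "\<forall>n. operator_on smul (*) X (\<xi> n)"
    and lim: "\<forall>x\<in>X. (\<lambda>n. \<xi> n x) \<longlonglongrightarrow> 0"
  have bdd: "bounded (range (\<lambda>n. \<xi> n x))" if "x \<in> X" for x
    using lim that by (intro convergent_imp_bounded) blast
  obtain C where C: "\<And>n x. x \<in> X \<Longrightarrow> norm (\<xi> n x) \<le> C * norm x"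
    using uniform_boundedness[of X \<xi>] X op bdd by (auto simp: separable_banach_subspace_def)
  define T where "T x = Bcontfun (\<lambda>n. \<xi> n x)" for x
  have T: "apply_bcontfun (T x) n = \<xi> n x" if "x \<in> X" for x n
    using bdd[OF that] by (simp add: T_def Bcontfun_inverse bcontfun_def)
  have sub: "subspace X" using X by (simp add: separable_banach_subspace_def)
  have "operator_on smul scale_bcontfun X T"
    unfolding operator_on_def
  proof (intro conjI ballI allI)
    fix x y assume "x \<in> X" "y \<in> X"
    then show "T (x + y) = T x + T y"
      using op subspace_add[OF sub] by (auto intro!: bcontfun_eqI simp: T plus_bcontfun.rep_eq operator_on_def)
  next
    fix c x assume "x \<in> X"
    then show "T (smul c x) = scale_bcontfun c (T x)"
      using op subspace_scale[OF sub] by (auto intro!: bcontfun_eqI simp: T scale_bcontfun.rep_eq operator_on_def)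
  next
    show "\<exists>C. \<forall>x\<in>X. norm (T x) \<le> C * norm x"
      by (intro exI[of _ C] ballI norm_bound) (simp add: T C)
  qed
  moreover have "T ` X \<subseteq> c0" using lim by (auto simp: c0_def T)
  ultimately obtain T' where T': "operator_on smul scale_bcontfun UNIV T'" "range T' \<subseteq> c0" "\<And>x. x \<in> X \<Longrightarrow> T' x = T x"
    using c0ext X unfolding separable_c0_extension_property_def by metis
  have "\<exists>\<psi>. \<psi> \<in> dual smul \<and> blinfun_apply \<psi> = (\<lambda>x. apply_bcontfun (T' x) n)" for n
  proof -
    have "operator_on smul (*) UNIV (\<lambda>x. apply_bcontfun (T' x) n)"
      using T'(1) unfolding operator_on_def
      by (auto simp: plus_bcontfun.rep_eq scale_bcontfun.rep_eq) (meson norm_bounded order_trans)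
    then show ?thesis using operator_on_UNIV_imp_dual by metis
  qed
  then obtain \<psi> where \<psi>: "\<And>n. \<psi> n \<in> dual smul" "\<And>n. blinfun_apply (\<psi> n) = (\<lambda>x. apply_bcontfun (T' x) n)"
    by metis
  have "weak_star_null smul \<psi>"
    unfolding weak_star_null_iff
  proof (intro conjI allI)
    show "range \<psi> \<subseteq> dual smul" using \<psi>(1) by blast
    fix x
    have "T' x \<in> c0" using T'(2) by blast
    then show "(\<lambda>n. blinfun_apply (\<psi> n) x) \<longlonglongrightarrow> 0" by (simp add: c0_def \<psi>(2))
  qed
  moreover have "blinfun_apply (\<psi> n) x = \<xi> (id n) x" if "x \<in> X" for n x
    using that by (simp add: \<psi> T' T)
  ultimately show "\<exists>r \<psi>. strict_mono (r :: nat \<Rightarrow> nat) \<and> weak_star_null smul \<psi> \<and>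
           (\<forall>n. \<forall>x\<in>X. blinfun_apply (\<psi> n) x = \<xi> (r n) x)"
    using strict_mono_id by blast
qed

end

section \<open>Spaces of continuous functions\<close>

lemma dirac_apply: "blinfun_apply (dirac x) f = apply_bcontfun f x"
  by (simp add: dirac.rep_eq)

lemma dirac_in_dual: "dirac x \<in> dual scale_bcontfun"
  by (simp add: dual_def dirac_apply scale_bcontfun.rep_eq)

lemma norm_dirac_le: "norm (dirac x) \<le> 1"
  by (rule norm_blinfun_bound) (auto simp: dirac_apply norm_bounded)

text \<open>
The supremum of \<open>\<bar>f x\<bar>\<close> over the points \<open>x\<close> is the norm of \<open>f\<close>, so the Dirac functionals already norm
the space.
\<close>

lemma norming_if_contains_dirac:
  fixes A :: "(('k::t2_space \<Rightarrow>\<^sub>C 'f::real_or_complex) \<Rightarrow>\<^sub>L 'f) set"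
  assumes "range dirac \<subseteq> A" "A \<subseteq> dual scale_bcontfun" "A \<subseteq> cball 0 1"
  shows "norming scale_bcontfun A"
proof (rule normingI_unit_functionals[OF assms(2,3)])
  fix f :: "'k \<Rightarrow>\<^sub>C 'f"
  have "bounded A" by (rule bounded_subset[OF bounded_cball assms(3)])
  then have "norm (apply_bcontfun f x) \<le> sup_norm_on A (\<lambda>\<xi>. blinfun_apply \<xi> f)" for x
    using norm_le_sup_norm_on[OF bounded_evaluation_image, of A "dirac x" f] assms(1)
    by (auto simp: dirac_apply)
  then show "norm f \<le> sup_norm_on A (\<lambda>\<xi>. blinfun_apply \<xi> f)" by (rule norm_bound)
qed

lemma continuous_map_dirac:
  "continuous_map euclidean (weak_star scale_bcontfun) (dirac :: 'k::t2_space \<Rightarrow> ('k \<Rightarrow>\<^sub>C 'f::real_or_complex) \<Rightarrow>\<^sub>L 'f)"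
  unfolding weak_star_def continuous_map_in_subtopology continuous_on_strong_operator_topo_iff_coordinatewise
  using dirac_in_dual by (auto simp: dirac_apply continuous_map_iff_continuous2 intro: continuous_on_apply_bcontfun)

lemma gelfand_phillips_bcontfun_if_ssp:
  assumes "selectively_seq_pseudocompact (euclidean :: 'k::t2_space topology)"
  shows "gelfand_phillips (scale_bcontfun :: 'f::real_or_complex \<Rightarrow> ('k \<Rightarrow>\<^sub>C 'f) \<Rightarrow> ('k \<Rightarrow>\<^sub>C 'f))"
proof (rule gelfand_phillips_if_ssp_at_norming)
  show "norming (scale_bcontfun :: 'f \<Rightarrow> ('k \<Rightarrow>\<^sub>C 'f) \<Rightarrow> ('k \<Rightarrow>\<^sub>C 'f)) (range dirac)"
    by (rule norming_if_contains_dirac) (auto simp: dirac_in_dual norm_dirac_le)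
  show "selectively_seq_pseudocompact_at (weak_star scale_bcontfun) (range (dirac :: 'k \<Rightarrow> ('k \<Rightarrow>\<^sub>C 'f) \<Rightarrow>\<^sub>L 'f))"
    using assms unfolding selectively_seq_pseudocompact_def
    by (intro ssp_at_continuous_image[OF _ continuous_map_dirac]) auto
qed

lemma gelfand_phillips_bcontfun_if_probability_ssp:
  fixes A :: "(('k::t2_space \<Rightarrow>\<^sub>C 'f::real_or_complex) \<Rightarrow>\<^sub>L 'f) set"
  assumes "range dirac \<subseteq> A" "A \<subseteq> probability_functionals" "selectively_seq_pseudocompact_at probability_topology A"
  shows "gelfand_phillips (scale_bcontfun :: 'f \<Rightarrow> ('k \<Rightarrow>\<^sub>C 'f) \<Rightarrow> ('k \<Rightarrow>\<^sub>C 'f))"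
proof (rule gelfand_phillips_if_ssp_at_norming)
  show "norming scale_bcontfun A"
    using assms(1,2) by (intro norming_if_contains_dirac) (auto simp: probability_functionals_def)
  show "selectively_seq_pseudocompact_at (weak_star scale_bcontfun) A"
    by (rule ssp_at_subtopology[OF assms(3)[unfolded probability_topology_def] assms(2)])
qed

theorem corollary2p2:
  fixes smul :: "'f::real_or_complex \<Rightarrow> 'a::banach \<Rightarrow> 'a"
  shows
    "(banach_over smul \<and> infinite_dimensional smul \<longrightarrow>
        (selectively_seq_pseudocompact (subtopology (weak_star smul) (cball 0 1))
           \<longrightarrow> gelfand_phillips smul) \<and>
        (separable_space (euclidean :: 'a topology) \<longrightarrow> gelfand_phillips smul) \<and>
        (separable_c0_extension_property smul \<longrightarrow> gelfand_phillips smul) \<and>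
        (separably_weak_star_extensible smul \<longrightarrow> gelfand_phillips smul) \<and>
        (separable_c0_extension_property smul \<longrightarrow> separably_weak_star_extensible smul) \<and>
        ((\<exists>S. norming smul S \<and> selectively_seq_pseudocompact_at (weak_star smul) S)
           \<longrightarrow> gelfand_phillips smul)) \<and>
     (compact (UNIV :: 'k::t2_space set) \<and> infinite (UNIV :: 'k set) \<longrightarrow>
        (selectively_seq_pseudocompact (euclidean :: 'k topology)
           \<longrightarrow> gelfand_phillips (scale_bcontfun :: 'f \<Rightarrow> ('k \<Rightarrow>\<^sub>C 'f) \<Rightarrow> ('k \<Rightarrow>\<^sub>C 'f))) \<and>
        ((\<exists>A :: (('k \<Rightarrow>\<^sub>C 'f) \<Rightarrow>\<^sub>L 'f) set. range dirac \<subseteq> A \<and> A \<subseteq> probability_functionals \<and>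
              selectively_seq_pseudocompact_at probability_topology A)
           \<longrightarrow> gelfand_phillips (scale_bcontfun :: 'f \<Rightarrow> ('k \<Rightarrow>\<^sub>C 'f) \<Rightarrow> ('k \<Rightarrow>\<^sub>C 'f))))"
proof (intro conjI impI)
  assume "banach_over smul \<and> infinite_dimensional smul"
  then interpret banach_over smul by blast
  show "gelfand_phillips smul"
    if "selectively_seq_pseudocompact (subtopology (weak_star smul) (cball 0 1))"
    by (rule gelfand_phillips_if_dual_ball_ssp[OF that])
  show "gelfand_phillips smul" if "separable_space (euclidean :: 'a topology)"
    using that by (rule gelfand_phillips_if_separable)
  show ext: "separably_weak_star_extensible smul" if "separable_c0_extension_property smul"
    using that by (rule separably_weak_star_extensible_if_c0_extension)
  show gp: "gelfand_phillips smul" if "separably_weak_star_extensible smul"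
    using that by (rule gelfand_phillips_if_separably_weak_star_extensible)
  show "gelfand_phillips smul" if "separable_c0_extension_property smul"
    by (rule gp[OF ext[OF that]])
  show "gelfand_phillips smul"
    if ex: "\<exists>S. norming smul S \<and> selectively_seq_pseudocompact_at (weak_star smul) S"
  proof -
    obtain S where "norming smul S" "selectively_seq_pseudocompact_at (weak_star smul) S"
      using ex by blast
    then show ?thesis by (rule gelfand_phillips_if_ssp_at_norming)
  qed
next
  show "gelfand_phillips (scale_bcontfun :: 'f \<Rightarrow> ('k \<Rightarrow>\<^sub>C 'f) \<Rightarrow> ('k \<Rightarrow>\<^sub>C 'f))"
    if "selectively_seq_pseudocompact (euclidean :: 'k topology)"
    using that by (rule gelfand_phillips_bcontfun_if_ssp)
  show "gelfand_phillips (scale_bcontfun :: 'f \<Rightarrow> ('k \<Rightarrow>\<^sub>C 'f) \<Rightarrow> ('k \<Rightarrow>\<^sub>C 'f))"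
    if ex: "\<exists>A :: (('k \<Rightarrow>\<^sub>C 'f) \<Rightarrow>\<^sub>L 'f) set. range dirac \<subseteq> A \<and> A \<subseteq> probability_functionals \<and>
      selectively_seq_pseudocompact_at probability_topology A"
  proof -
    obtain A :: "(('k \<Rightarrow>\<^sub>C 'f) \<Rightarrow>\<^sub>L 'f) set" where "range dirac \<subseteq> A" "A \<subseteq> probability_functionals"
      "selectively_seq_pseudocompact_at probability_topology A"
      using ex by blast
    then show ?thesis by (rule gelfand_phillips_bcontfun_if_probability_ssp)
  qed
qed

end
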